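(* There is $\epsilon_0>0$, independent of $\lambda$, such that for any $0<\epsilon<\epsilon_0$, under the conditions $\|V\|_*<\epsilon^9$, $|v_q|>\epsilon^{10}$, $|\sigma||A|^2<\epsilon^{11}$ ($A\in\mathbb C$), and for any sufficiently large $k$, $k>k_1(V,\epsilon_0)$, the following holds. Suppose $t$ belongs to the $(\frac18k^{-1}\epsilon^{10})$-neighborhood in $K$ of the resonant set $\chi_q(k,\epsilon)$. Then there is a pair of functions $u^\pm(x,t)$ and corresponding real values $\lambda^\pm(t)$ satisfying $$-\Delta u^\pm+V(x)u^\pm+\sigma|u^\pm|^2u^\pm=\lambda^\pm u^\pm,\quad x\in Q,$$ and the quasi-periodic boundary conditions, and $$u^\pm(x,t)=Ae^{i\langle P_j(t),x\rangle}\big(\psi_{-1}^\pm(x,t)+\phi^\pm(x,t)\big),\qquad \lambda^\pm(t)=\hat\lambda^\pm(t)+O(\epsilon^{11}),$$ where $\psi_{-1}^\pm(x,t)=\hat E^\pm(t)_{jj}+\hat E^\pm(t)_{j-q,j}e^{-i\langle q,x\rangle}$ and $\phi^\pm(x,t)$ is periodic in $x$ and satisfies $\|\phi^\pm\|_*\le\epsilon$.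
   Context: Setting ($l=1$, $n=2$). $\sigma\in\mathbb R$; $Q=[0,2\pi]^2$; $K=[0,1)^2$. $V(x)=\sum_{m\in\mathbb Z^2,\,0<|m|\le R_0}v_me^{i\langle m,x\rangle}$ is a real-valued trigonometric polynomial and $q\in\mathbb Z^2\setminus\{0\}$ is fixed with $v_q\ne0$. For a $2\pi$-periodic $W$ with Fourier coefficients $w_m$, $\|W\|_*=\sum_m|w_m|$. $P_j(t)=j+t$, $p_j(t)=|P_j(t)|$, $j\in\mathbb Z^2$. Quasi-periodic boundary conditions: $\partial_{x_s}^ru(\dots,x_s+2\pi,\dots)=e^{2\pi it_s}\partial_{x_s}^ru(x)$, $s=1,2$, $r=0,1$. Resonant set. $S(k)$ is the circle of radius $k$ centered at $0$, $S_q(k,\epsilon)=\{x\in S(k):\big||x|^2-|x-q|^2\big|<\epsilon\}$, $\mathcal K:\mathbb R^2\to K$, $\mathcal KP_m(t)=t$. $\chi_q(k,\epsilon)$ is a subset of $\mathcal KS_q(k,\epsilon)$ such that for each $t$ in it: there is $j\in\mathbb Z^2$ with $P_j(t)\in S_q(k,\epsilon)$ (so $|P_j(t)|=k$); $|p_j^2(t)-p_{j-q}^2(t)|<\epsilon$; $\min_{m\ne j,j-q}|p_j^2(t)-p_m^2(t)|>2\epsilon^6$. The relative measure of its complement in $\mathcal KS_q(k,\epsilon)$ is less than $c\epsilon$, with $c$ independent of $k$. For $t$ near $\chi_q(k,\epsilon)$, $j$ is the index attached to a nearby point of $\chi_q(k,\epsilon)$. For $t$ in the $(\frac18k^{-1}\epsilon^{10})$-neighborhood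 of $\chi_q(k,\epsilon)$ and $z$ on either circle $C_1^\pm=\{z:|z-\hat\lambda^\pm(t)|=d\}$, $d=\frac13\epsilon^{10}$, one has $2|p_m^2(t)-z|\ge\epsilon^6$ for $m\ne j,j-q$ and both $|\hat\lambda^+(t)-z|,|\hat\lambda^-(t)-z|\ge\frac1{12}\epsilon^{10}$. Model matrix. $\hat\lambda^\pm(t)=a\pm b$, $2a=p_j^2+p_{j-q}^2$, $2b=(4|v_q|^2+(p_j^2-p_{j-q}^2)^2)^{1/2}$, are the eigenvalues of $\begin{pmatrix}p_j^2(t)&v_q\\ v_{-q}&p_{j-q}^2(t)\end{pmatrix}$; $\hat E^\pm(t)$ is the corresponding rank-one orthogonal spectral projection, viewed as a matrix indexed by $\mathbb Z^2\times\mathbb Z^2$ with entries vanishing unless both indices lie in $\{j,j-q\}$ (first coordinate $\leftrightarrow j$, second $\leftrightarrow j-q$). *)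

theory Defs
  imports "HOL-Analysis.Analysis"
begin

definition rvec :: "int ^ 2 \<Rightarrow> real ^ 2" where
  "rvec m = (\<chi> i. real_of_int (m $ i))"

definition cell :: "(real ^ 2) set" where
  "cell = {t. \<forall>i. 0 \<le> t $ i \<and> t $ i < 1}"

definition torus_box :: "(real ^ 2) set" where
  "torus_box = cbox 0 (\<chi> i. 2 * pi)"

definition P :: "int ^ 2 \<Rightarrow> real ^ 2 \<Rightarrow> real ^ 2" where
  "P j t = rvec j + t"

definition p :: "int ^ 2 \<Rightarrow> real ^ 2 \<Rightarrow> real" where
  "p j t = norm (P j t)"

definition fourier_coeff :: "(real ^ 2 \<Rightarrow> complex) \<Rightarrow> int ^ 2 \<Rightarrow> complex" where
  "fourier_coeff W m =
     integral torus_box (\<lambda>x. W x * cis (- (rvec m \<bullet> x))) / complex_of_real ((2 * pi)\<^sup>2)"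

text \<open>The norm takes values in \<^typ>\<open>ennreal\<close>, so that a divergent series of Fourier coefficients
  has norm \<open>\<infinity>\<close> and not the default value 0.\<close>

definition star_norm :: "(real ^ 2 \<Rightarrow> complex) \<Rightarrow> ennreal" where
  "star_norm W = (\<Sum>\<^sub>\<infinity>m\<in>UNIV. ennreal (cmod (fourier_coeff W m)))"

definition periodic2 :: "(real ^ 2 \<Rightarrow> complex) \<Rightarrow> bool" where
  "periodic2 W \<longleftrightarrow> (\<forall>x s. W (x + (2 * pi) *\<^sub>R axis s 1) = W x)"

definition trig_poly :: "real \<Rightarrow> (int ^ 2 \<Rightarrow> complex) \<Rightarrow> real ^ 2 \<Rightarrow> complex" where
  "trig_poly R0 v x = (\<Sum>m | 0 < norm (rvec m) \<and> norm (rvec m) \<le> R0. v m * cis (rvec m \<bullet> x))"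

text \<open>The coefficient family \<open>v\<close> is total; requiring it to vanish off the index range of the sum
  makes \<open>v m\<close> the \<open>m\<close>-th Fourier coefficient of the potential for every \<open>m\<close>.\<close>

definition real_trig_potential :: "real \<Rightarrow> (int ^ 2 \<Rightarrow> complex) \<Rightarrow> bool" where
  "real_trig_potential R0 v \<longleftrightarrow>
     (\<forall>m. v m \<noteq> 0 \<longrightarrow> 0 < norm (rvec m) \<and> norm (rvec m) \<le> R0) \<and>
     (\<forall>x. trig_poly R0 v x \<in> \<real>)"

definition pdiff :: "2 \<Rightarrow> (real ^ 2 \<Rightarrow> complex) \<Rightarrow> real ^ 2 \<Rightarrow> complex" where
  "pdiff s f x = vector_derivative (\<lambda>h. f (x + h *\<^sub>R axis s 1)) (at 0)"

definition has_partials :: "(real ^ 2 \<Rightarrow> complex) \<Rightarrow> bool" where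
  "has_partials f \<longleftrightarrow> (\<forall>s x. (\<lambda>h. f (x + h *\<^sub>R axis s 1)) differentiable (at 0))"

definition C2 :: "(real ^ 2 \<Rightarrow> complex) \<Rightarrow> bool" where
  "C2 f \<longleftrightarrow> continuous_on UNIV f \<and> has_partials f \<and>
     (\<forall>s. continuous_on UNIV (pdiff s f) \<and> has_partials (pdiff s f) \<and>
       (\<forall>r. continuous_on UNIV (pdiff r (pdiff s f))))"

definition laplacian :: "(real ^ 2 \<Rightarrow> complex) \<Rightarrow> real ^ 2 \<Rightarrow> complex" where
  "laplacian f x = (\<Sum>s\<in>UNIV. pdiff s (pdiff s f) x)"

definition quasi_periodic :: "real ^ 2 \<Rightarrow> (real ^ 2 \<Rightarrow> complex) \<Rightarrow> bool" where
  "quasi_periodic t u \<longleftrightarrow>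
     (\<forall>x s. u (x + (2 * pi) *\<^sub>R axis s 1) = cis (2 * pi * t $ s) * u x \<and>
            pdiff s u (x + (2 * pi) *\<^sub>R axis s 1) = cis (2 * pi * t $ s) * pdiff s u x)"

text \<open>The superscripts \<open>\<plusminus>\<close> are encoded by a sign \<open>s \<in> {1, -1}\<close>.\<close>

definition model_eigenvalue ::
    "real \<Rightarrow> (int ^ 2 \<Rightarrow> complex) \<Rightarrow> int ^ 2 \<Rightarrow> int ^ 2 \<Rightarrow> real ^ 2 \<Rightarrow> real" where
  "model_eigenvalue s v q j t =
     ((p j t)\<^sup>2 + (p (j - q) t)\<^sup>2) / 2 +
     s * (sqrt (4 * (cmod (v q))\<^sup>2 + ((p j t)\<^sup>2 - (p (j - q) t)\<^sup>2)\<^sup>2) / 2)"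

definition model_matrix ::
    "(int ^ 2 \<Rightarrow> complex) \<Rightarrow> int ^ 2 \<Rightarrow> int ^ 2 \<Rightarrow> real ^ 2 \<Rightarrow> complex ^ 2 ^ 2" where
  "model_matrix v q j t =
     vector [vector [complex_of_real ((p j t)\<^sup>2), v q],
             vector [v (- q), complex_of_real ((p (j - q) t)\<^sup>2)]]"

definition orth_proj_onto :: "(complex ^ 2) set \<Rightarrow> complex ^ 2 ^ 2 \<Rightarrow> bool" where
  "orth_proj_onto U E \<longleftrightarrow>
     E ** E = E \<and> (\<forall>a b. E $ a $ b = cnj (E $ b $ a)) \<and> range (\<lambda>y. E *v y) = U"

definition spectral_proj :: "complex ^ 2 ^ 2 \<Rightarrow> complex \<Rightarrow> complex ^ 2 ^ 2" where
  "spectral_proj M z = (THE E. orth_proj_onto {y. M *v y = z *s y} E)"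

definition model_proj ::
    "real \<Rightarrow> (int ^ 2 \<Rightarrow> complex) \<Rightarrow> int ^ 2 \<Rightarrow> int ^ 2 \<Rightarrow> real ^ 2 \<Rightarrow> int ^ 2 \<Rightarrow> int ^ 2 \<Rightarrow> complex" where
  "model_proj s v q j t m n =
     (let E = spectral_proj (model_matrix v q j t) (complex_of_real (model_eigenvalue s v q j t))
      in if m \<in> {j, j - q} \<and> n \<in> {j, j - q}
         then E $ (if m = j then 1 else 2) $ (if n = j then 1 else 2)
         else 0)"

definition psi_lead ::
    "real \<Rightarrow> (int ^ 2 \<Rightarrow> complex) \<Rightarrow> int ^ 2 \<Rightarrow> int ^ 2 \<Rightarrow> real ^ 2 \<Rightarrow> real ^ 2 \<Rightarrow> complex" where
  "psi_lead s v q j t x =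
     model_proj s v q j t j j + model_proj s v q j t (j - q) j * cis (- (rvec q \<bullet> x))"

definition res_arc :: "int ^ 2 \<Rightarrow> real \<Rightarrow> real \<Rightarrow> (real ^ 2) set" where
  "res_arc q k \<epsilon> = {x \<in> sphere 0 k. \<bar>(norm x)\<^sup>2 - (norm (x - rvec q))\<^sup>2\<bar> < \<epsilon>}"

definition to_cell :: "real ^ 2 \<Rightarrow> real ^ 2" where  \<comment> \<open>\<open>to_cell (P m t) = t\<close> for \<open>t \<in> cell\<close>\<close>
  "to_cell x = (\<chi> i. frac (x $ i))"

text \<open>One-dimensional measure of subsets \<open>T\<close> of \<open>to_cell ` res_arc q k \<epsilon>\<close>. On a circle of positive
  radius two points with the same image differ by a lattice vector, so \<^const>\<open>to_cell\<close> is
  injective there up to finitely many points; the length of \<open>T\<close> is therefore the arc length of its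
  preimage in \<open>res_arc q k \<epsilon>\<close>, computed in the angular parameter.\<close>

definition arc_angles :: "int ^ 2 \<Rightarrow> real \<Rightarrow> real \<Rightarrow> (real ^ 2) set \<Rightarrow> real set" where
  "arc_angles q k \<epsilon> T =
     {\<theta> \<in> {0..<2 * pi}.
        let x = vector [k * cos \<theta>, k * sin \<theta>] in x \<in> res_arc q k \<epsilon> \<and> to_cell x \<in> T}"

definition arc_length :: "int ^ 2 \<Rightarrow> real \<Rightarrow> real \<Rightarrow> (real ^ 2) set \<Rightarrow> real" where
  "arc_length q k \<epsilon> T = k * measure lebesgue (arc_angles q k \<epsilon> T)"

definition res_index :: "int ^ 2 \<Rightarrow> real \<Rightarrow> real \<Rightarrow> real ^ 2 \<Rightarrow> int ^ 2 \<Rightarrow> bool" where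
  "res_index q k \<epsilon> t j \<longleftrightarrow>
     P j t \<in> res_arc q k \<epsilon> \<and>
     \<bar>(p j t)\<^sup>2 - (p (j - q) t)\<^sup>2\<bar> < \<epsilon> \<and>
     (\<forall>m. m \<noteq> j \<and> m \<noteq> j - q \<longrightarrow> \<bar>(p j t)\<^sup>2 - (p m t)\<^sup>2\<bar> > 2 * \<epsilon> ^ 6)"

definition resonant_set :: "int ^ 2 \<Rightarrow> real \<Rightarrow> real \<Rightarrow> real \<Rightarrow> (real ^ 2) set \<Rightarrow> bool" where
  "resonant_set q c k \<epsilon> X \<longleftrightarrow>
     X \<subseteq> to_cell ` res_arc q k \<epsilon> \<and>
     (\<forall>t\<in>X. \<exists>j. res_index q k \<epsilon> t j) \<and>
     arc_angles q k \<epsilon> X \<in> sets lebesgue \<and>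
     arc_length q k \<epsilon> (to_cell ` res_arc q k \<epsilon> - X) / arc_length q k \<epsilon> (to_cell ` res_arc q k \<epsilon>)
       < c * \<epsilon>"

definition res_nbhd :: "real \<Rightarrow> real \<Rightarrow> (real ^ 2) set \<Rightarrow> (real ^ 2) set" where
  "res_nbhd k \<epsilon> X = {t \<in> cell. \<exists>t0\<in>X. dist t t0 < 1 / 8 * inverse k * \<epsilon> ^ 10}"

definition near_res_index ::
    "int ^ 2 \<Rightarrow> real \<Rightarrow> real \<Rightarrow> (real ^ 2) set \<Rightarrow> real ^ 2 \<Rightarrow> int ^ 2 \<Rightarrow> bool" where
  "near_res_index q k \<epsilon> X t j \<longleftrightarrow>
     (\<exists>t0\<in>X. dist t t0 < 1 / 8 * inverse k * \<epsilon> ^ 10 \<and> res_index q k \<epsilon> t0 j)"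

text \<open>Separation of the circles around the two model eigenvalues from the unperturbed spectrum. It
  is an additional property of the resonant set: \<^const>\<open>res_index\<close> keeps \<open>(p m t)\<^sup>2\<close> away
  from \<open>(p j t)\<^sup>2\<close>, but not from \<open>(p (j - q) t)\<^sup>2\<close>, near which one model eigenvalue may lie.\<close>

definition separated ::
    "(int ^ 2 \<Rightarrow> complex) \<Rightarrow> int ^ 2 \<Rightarrow> real \<Rightarrow> real \<Rightarrow> (real ^ 2) set \<Rightarrow> bool" where
  "separated v q k \<epsilon> X \<longleftrightarrow>
     (\<forall>t\<in>res_nbhd k \<epsilon> X. \<forall>j. near_res_index q k \<epsilon> X t j \<longrightarrow>
       (\<forall>s\<in>{1, -1}. \<forall>z\<in>sphere (complex_of_real (model_eigenvalue s v q j t)) (1 / 3 * \<epsilon> ^ 10).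
          (\<forall>m. m \<noteq> j \<and> m \<noteq> j - q \<longrightarrow> 2 * cmod (complex_of_real ((p m t)\<^sup>2) - z) \<ge> \<epsilon> ^ 6) \<and>
          (\<forall>s'\<in>{1, -1}.
             cmod (complex_of_real (model_eigenvalue s' v q j t) - z) \<ge> 1 / 12 * \<epsilon> ^ 10)))"

end

theory Submission
  imports Defs
begin

text \<open>With \<open>P = P j t\<close> and \<open>u(x) = A c cis(P \<bullet> x) \<Sum> w m cis(m \<bullet> x)\<close>, where \<open>c\<close> is the first entry of the unit
  eigenvector \<open>e\<close> of the model matrix, the problem becomes
  \<open>|m + P|\<^sup>2 w m + (V * w) m + \<tau> (w * w\<^sup>* * w) m = \<lambda> w m\<close> in the convolution algebra of absolutely
  summable families, with \<open>\<tau> = \<sigma>|A|\<^sup>2c\<^sup>2\<close>; here \<open>m = 0\<close> stands for the index \<open>j\<close> and \<open>m = - q\<close> for \<open>j - q\<close>.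
  Factoring out \<open>c\<close>, which may be as small as \<open>\<epsilon>\<^sup>9\<close>, leaves a perturbation problem around the unit
  vector \<open>e\<close>, solved by a contraction. Its solution has summable \<open>|m + P|\<^sup>2 w m\<close> because the other terms
  of the equation are summable, so \<open>u\<close> is twice continuously differentiable.\<close>

section \<open>Absolutely summable families and convolution\<close>

text \<open>The obstacle is the constant 1 in the bound of the correction by \<epsilon>. The cubic
  term, of size \<epsilon>^11, acts on the second model eigenvector against a gap of only 2
  \<epsilon>^10, so the correction inside the block is of order \<epsilon> itself: shrinking
  \<epsilon> does not improve the ratio, and norm estimates alone give a constant above 1. The
  leading part is therefore computed exactly. At the unperturbed vector the cubic term has the
  component \<tau> c d (c^2 - |d|^2) along the second eigenvector, of modulus at most |\<tau>| / 2,
  and this costs 3/8 \<epsilon>. Every other contribution to the correction carries at least one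
  further factor \<epsilon>, and the threshold 1/2000 makes these fit into what remains. The
  contraction does not see self-adjointness: it delivers the eigenvalue shift as a complex number.
  That the eigenvalue is real is deduced afterwards from the equation it solves.\<close>

no_notation Infinite_Set_Sum.abs_summable_on (infix \<open>abs'_summable'_on\<close> 50)

text \<open>A type, not a predicate on families, so that the class \<open>banach\<close> gives
  access to \<open>Banach_fix\<close> and to the theory of bounded linear and bilinear maps.\<close>

typedef 'a ell1 = "{f :: 'a \<Rightarrow> complex. f abs_summable_on UNIV}"
  morphisms coef Ell1
  by (intro exI[of _ "\<lambda>_. 0"]) auto

lemma summable_coef: "coef w abs_summable_on UNIV"
  using coef[of w] by simp

lemma coef_Ell1: "f abs_summable_on UNIV \<Longrightarrow> coef (Ell1 f) = f"
  by (simp add: Ell1_inverse)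

lemma ell1_eqI: "(\<And>m. coef w m = coef z m) \<Longrightarrow> w = z"
  by (metis coef_inject ext)

lemma abs_summable_add:
  fixes f g :: "'a \<Rightarrow> 'b::real_normed_vector"
  assumes "f abs_summable_on A" "g abs_summable_on A"
  shows "(\<lambda>x. f x + g x) abs_summable_on A"
  by (rule Infinite_Sum.abs_summable_on_comparison_test'[of "\<lambda>x. norm (f x) + norm (g x)"])
     (use assms in \<open>auto intro: summable_on_add norm_triangle_ineq\<close>)

instantiation ell1 :: (type) real_normed_vector
begin

definition zero_ell1 :: "'a ell1" where "zero_ell1 = Ell1 (\<lambda>_. 0)"
definition plus_ell1 :: "'a ell1 \<Rightarrow> 'a ell1 \<Rightarrow> 'a ell1" where
  "plus_ell1 w z = Ell1 (\<lambda>m. coef w m + coef z m)"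
definition uminus_ell1 :: "'a ell1 \<Rightarrow> 'a ell1" where "uminus_ell1 w = Ell1 (\<lambda>m. - coef w m)"
definition minus_ell1 :: "'a ell1 \<Rightarrow> 'a ell1 \<Rightarrow> 'a ell1" where
  "minus_ell1 w z = Ell1 (\<lambda>m. coef w m - coef z m)"
definition scaleR_ell1 :: "real \<Rightarrow> 'a ell1 \<Rightarrow> 'a ell1" where
  "scaleR_ell1 r w = Ell1 (\<lambda>m. r *\<^sub>R coef w m)"
definition norm_ell1 :: "'a ell1 \<Rightarrow> real" where "norm_ell1 w = (\<Sum>\<^sub>\<infinity>m. cmod (coef w m))"
definition sgn_ell1 :: "'a ell1 \<Rightarrow> 'a ell1" where "sgn_ell1 w = inverse (norm w) *\<^sub>R w"
definition dist_ell1 :: "'a ell1 \<Rightarrow> 'a ell1 \<Rightarrow> real" where "dist_ell1 w z = norm (w - z)"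
definition [code del]: "(uniformity :: ('a ell1 \<times> 'a ell1) filter) =
  (INF e\<in>{0<..}. principal {(x, y). dist x y < e})"
definition [code del]: "open (U :: 'a ell1 set) \<longleftrightarrow>
  (\<forall>x\<in>U. eventually (\<lambda>(x', y). x' = x \<longrightarrow> y \<in> U) uniformity)"

lemma coef_zero: "coef (0 :: 'a ell1) m = 0"
  by (simp add: zero_ell1_def coef_Ell1)

lemma coef_plus: "coef (w + z :: 'a ell1) m = coef w m + coef z m"
  by (simp add: plus_ell1_def coef_Ell1 abs_summable_add summable_coef)

lemma coef_uminus: "coef (- w :: 'a ell1) m = - coef w m"
  using summable_coef[of w] by (simp add: uminus_ell1_def coef_Ell1)

lemma coef_minus: "coef (w - z :: 'a ell1) m = coef w m - coef z m"
  using abs_summable_add[OF summable_coef[of w] summable_coef[of "- z"]]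
  by (simp add: minus_ell1_def coef_Ell1 coef_uminus)

lemma coef_scaleR: "coef (r *\<^sub>R w :: 'a ell1) m = r *\<^sub>R coef w m"
  using summable_on_cmult_right[OF summable_coef[of w], of "\<bar>r\<bar>"]
  by (simp add: scaleR_ell1_def coef_Ell1 norm_mult)

lemmas coef_simps = coef_zero coef_plus coef_uminus coef_minus coef_scaleR

instance
proof
  fix w z y :: "'a ell1" and r s :: real
  show "w + z + y = w + (z + y)" "w + z = z + w" "0 + w = w" "- w + w = 0" "w - z = w + - z"
    by (rule ell1_eqI; simp add: coef_simps)+
  show "r *\<^sub>R (w + z) = r *\<^sub>R w + r *\<^sub>R z" "(r + s) *\<^sub>R w = r *\<^sub>R w + s *\<^sub>R w"
    "r *\<^sub>R s *\<^sub>R w = (r * s) *\<^sub>R w" "1 *\<^sub>R w = w"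
    by (rule ell1_eqI; simp add: coef_simps algebra_simps)+
  show "norm (r *\<^sub>R w) = \<bar>r\<bar> * norm w"
    by (simp add: norm_ell1_def coef_simps infsum_cmult_right' norm_mult)
  have "norm (w + z) \<le> (\<Sum>\<^sub>\<infinity>m. cmod (coef w m) + cmod (coef z m))"
    unfolding norm_ell1_def
    by (rule infsum_mono)
       (simp_all add: coef_plus norm_triangle_ineq summable_on_add summable_coef
         summable_coef[of "w + z", unfolded coef_plus])
  also have "\<dots> = norm w + norm z"
    by (simp add: norm_ell1_def infsum_add summable_coef)
  finally show "norm (w + z) \<le> norm w + norm z" .
  show "(norm w = 0) = (w = 0)"
  proof
    assume "norm w = 0"
    then have "cmod (coef w m) = 0" for m
      using nonneg_infsum_le_0D[of "\<lambda>m. cmod (coef w m)" UNIV m] summable_coef[of w]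
      by (simp add: norm_ell1_def)
    then show "w = 0" by (intro ell1_eqI) (simp add: coef_zero)
  qed (simp add: norm_ell1_def coef_zero)
qed (simp_all add: dist_ell1_def sgn_ell1_def uniformity_ell1_def open_ell1_def)

end

lemma sum_coef_le_norm: "finite F \<Longrightarrow> (\<Sum>m\<in>F. cmod (coef w m)) \<le> norm w"
  unfolding norm_ell1_def by (rule finite_sum_le_infsum) (auto simp: summable_coef)

lemma norm_coef_le: "cmod (coef w m) \<le> norm w"
  using sum_coef_le_norm[of "{m}" w] by simp

lemma norm_coef2_le: "m \<noteq> n \<Longrightarrow> cmod (coef w m) + cmod (coef w n) \<le> norm w"
  using sum_coef_le_norm[of "{m, n}" w] by simp

lemma norm_ell1_leI:
  assumes "\<And>F. finite F \<Longrightarrow> (\<Sum>m\<in>F. cmod (coef w m)) \<le> B"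
  shows "norm w \<le> B"
  unfolding norm_ell1_def by (rule infsum_le_finite_sums) (auto simp: summable_coef assms)

lemma abs_summable_bounded_sums:
  fixes f :: "'a \<Rightarrow> complex"
  assumes "\<And>F. finite F \<Longrightarrow> (\<Sum>m\<in>F. cmod (f m)) \<le> B"
  shows "f abs_summable_on UNIV"
  by (rule nonneg_bounded_partial_sums_imp_summable_on[of _ _ B]) (auto simp: assms)

lemma bounded_linear_coef: "bounded_linear (\<lambda>w. coef w m)"
  by (rule bounded_linear_intro[of _ 1]) (auto simp: coef_simps norm_coef_le)

text \<open>The limit is taken coefficientwise. Cauchy bounds on finite partial sums survive this
  limit and are uniform in the finite set, hence bound the norm.\<close>

instance ell1 :: (type) banach
proof
  fix X :: "nat \<Rightarrow> 'a ell1"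
  assume X: "Cauchy X"
  define L where "L m = lim (\<lambda>n. coef (X n) m)" for m
  have L: "(\<lambda>n. coef (X n) m) \<longlonglongrightarrow> L m" for m
    using bounded_linear.Cauchy[OF bounded_linear_coef X] Cauchy_convergent_iff
    by (auto simp: L_def convergent_LIMSEQ_iff[symmetric])
  have close: "(\<Sum>m\<in>F. cmod (coef (X n) m - L m)) \<le> e"
    if F: "finite F" and N: "\<forall>k\<ge>n. norm (X n - X k) < e" for F n e
  proof (rule LIMSEQ_le_const2)
    show "(\<lambda>k. \<Sum>m\<in>F. cmod (coef (X n) m - coef (X k) m)) \<longlonglongrightarrow> (\<Sum>m\<in>F. cmod (coef (X n) m - L m))"
      by (intro tendsto_intros L)
    show "\<exists>N. \<forall>k\<ge>N. (\<Sum>m\<in>F. cmod (coef (X n) m - coef (X k) m)) \<le> e"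
    proof (intro exI[of _ n] allI impI)
      fix k assume "k \<ge> n"
      then have "norm (X n - X k) < e" using N by auto
      then show "(\<Sum>m\<in>F. cmod (coef (X n) m - coef (X k) m)) \<le> e"
        using sum_coef_le_norm[OF F, of "X n - X k"] by (simp add: coef_minus)
    qed
  qed
  have cau: "\<exists>N. \<forall>n\<ge>N. \<forall>k\<ge>n. norm (X n - X k) < e" if "e > 0" for e
    using X that by (meson CauchyD le_trans)
  obtain N where N: "\<forall>k\<ge>N. norm (X N - X k) < 1" using cau[of 1] by auto
  have "(\<lambda>m. coef (X N) m - L m) abs_summable_on UNIV"
    by (rule abs_summable_bounded_sums[of _ 1]) (rule close[OF _ N])
  from abs_summable_add[OF this summable_coef[of "- X N"]]
  have sumL: "L abs_summable_on UNIV" by (simp add: coef_uminus)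
  have "X \<longlonglongrightarrow> Ell1 L"
  proof (rule LIMSEQ_I)
    fix r :: real assume "r > 0"
    then obtain N where N: "\<forall>n\<ge>N. \<forall>k\<ge>n. norm (X n - X k) < r / 2" using cau[of "r / 2"] by auto
    have "norm (X n - Ell1 L) < r" if "n \<ge> N" for n
    proof -
      have "norm (X n - Ell1 L) \<le> r / 2"
        by (rule norm_ell1_leI, unfold coef_minus coef_Ell1[OF sumL], rule close) (use N that in auto)
      then show ?thesis using \<open>r > 0\<close> by auto
    qed
    then show "\<exists>no. \<forall>n\<ge>no. norm (X n - Ell1 L) < r" by auto
  qed
  then show "convergent X" by (auto simp: convergent_def)
qed

section \<open>Point masses and the extension principle from them\<close>

definition delta :: "'a \<Rightarrow> complex \<Rightarrow> 'a ell1" where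
  "delta n z = Ell1 (\<lambda>m. if m = n then z else 0)"

lemma coef_delta: "coef (delta n z) m = (if m = n then z else 0)"
proof -
  have "(\<lambda>m. if m = n then z else 0) abs_summable_on UNIV"
    by (rule finite_nonzero_values_imp_summable_on) (rule finite_subset[of _ "{n}"]; auto)
  then show ?thesis by (simp add: delta_def coef_Ell1)
qed

lemma norm_delta: "norm (delta n z) = cmod z"
proof -
  have "(\<Sum>\<^sub>\<infinity>m. cmod (coef (delta n z) m)) = (\<Sum>\<^sub>\<infinity>m\<in>{n}. cmod z)"
    by (rule infsum_cong_neutral) (auto simp: coef_delta)
  then show ?thesis by (simp add: norm_ell1_def)
qed

lemma delta_has_sum: "((\<lambda>m. delta m (coef w m)) has_sum w) UNIV"
proof -
  have summ: "(\<lambda>m. delta m (coef w m)) summable_on UNIV"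
    by (rule abs_summable_summable) (simp add: norm_delta summable_coef)
  have "infsum (\<lambda>m. delta m (coef w m)) UNIV = w"
  proof (rule ell1_eqI)
    fix n
    have "coef (infsum (\<lambda>m. delta m (coef w m)) UNIV) n = (\<Sum>\<^sub>\<infinity>m. coef (delta m (coef w m)) n)"
      by (rule infsumI[OF has_sum_bounded_linear[OF bounded_linear_coef has_sum_infsum[OF summ]], symmetric])
    also have "\<dots> = (\<Sum>\<^sub>\<infinity>m\<in>{n}. coef w m)"
      by (rule infsum_cong_neutral) (auto simp: coef_delta)
    finally show "coef (infsum (\<lambda>m. delta m (coef w m)) UNIV) n = coef w n" by simp
  qed
  with summ show ?thesis by (simp add: has_sum_iff)
qed

text \<open>Every element is the norm-convergent sum of its point masses. Only real linearity is
  required, so that the antilinear \<open>star\<close> is covered too; hence \<open>z\<close> ranges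
  over all complex numbers.\<close>

lemma bounded_linear_eq_on_deltas:
  assumes "bounded_linear f" "bounded_linear g" "\<And>n z. f (delta n z) = g (delta n z)"
  shows "f w = g w"
  using has_sum_bounded_linear[OF assms(1) delta_has_sum[of w]]
    has_sum_bounded_linear[OF assms(2) delta_has_sum[of w]] assms(3)
  by (simp add: has_sum_unique)

section \<open>Diagonal multipliers, translations, convolution and involution\<close>

definition dmul :: "('a \<Rightarrow> complex) \<Rightarrow> 'a ell1 \<Rightarrow> 'a ell1" where
  "dmul d w = Ell1 (\<lambda>m. d m * coef w m)"

lemma abs_summable_mult_bounded:
  assumes "\<And>m. cmod (d m) \<le> B"
  shows "(\<lambda>m. d m * coef w m) abs_summable_on UNIV"
  by (rule Infinite_Sum.abs_summable_on_comparison_test'[of "\<lambda>m. B * cmod (coef w m)"])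
     (auto simp: norm_mult summable_coef assms intro: summable_on_cmult_right mult_right_mono)

text \<open>\<open>Ell1\<close> is unspecified off the summable families, so a bound on
  \<open>d\<close> is what gives \<open>dmul d\<close> its meaning.\<close>

lemma coef_dmul: "(\<And>m. cmod (d m) \<le> B) \<Longrightarrow> coef (dmul d w) m = d m * coef w m"
  using coef_Ell1[OF abs_summable_mult_bounded[of d B w]] by (simp add: dmul_def)

lemma norm_dmul_le:
  assumes "\<And>m. cmod (d m) \<le> B"
  shows "norm (dmul d w) \<le> B * norm w"
proof -
  have "norm (dmul d w) \<le> (\<Sum>\<^sub>\<infinity>m. B * cmod (coef w m))"
    unfolding norm_ell1_def
    by (rule infsum_mono)
       (use summable_coef[of "dmul d w"] assms in
         \<open>auto simp: coef_dmul[of d B] norm_mult summable_coef intro: summable_on_cmult_right mult_right_mono\<close>)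
  then show ?thesis by (simp add: norm_ell1_def infsum_cmult_right')
qed

text \<open>The type class provides real scalars only; complex scaling is a multiplier with constant
  symbol.\<close>

definition cscale :: "complex \<Rightarrow> 'a ell1 \<Rightarrow> 'a ell1" where
  "cscale a = dmul (\<lambda>_. a)"

lemma coef_cscale: "coef (cscale a w) m = a * coef w m"
  unfolding cscale_def by (rule coef_dmul[of _ "cmod a"]) simp

lemma norm_cscale: "norm (cscale a w) = cmod a * norm w"
  by (simp add: norm_ell1_def coef_cscale norm_mult infsum_cmult_right')

definition shift :: "'a::ab_group_add \<Rightarrow> complex \<Rightarrow> 'a ell1 \<Rightarrow> 'a ell1" where
  "shift n a w = Ell1 (\<lambda>m. a * coef w (m - n))"

lemma bij_diff: "bij (\<lambda>m. m - n :: 'a::ab_group_add)"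
  by (rule bij_betw_byWitness[of _ "\<lambda>m. m + n"]) auto

lemma bij_uminus_group: "bij (uminus :: 'a::ab_group_add \<Rightarrow> 'a)"
  by (rule bij_betw_byWitness[of _ uminus]) auto

lemma coef_shift: "coef (shift n a w) m = a * coef w (m - n)"
proof -
  have "(\<lambda>m. cmod (coef w (m - n))) summable_on UNIV"
    using summable_on_reindex_bij_betw[OF bij_diff[of n], of "\<lambda>m. cmod (coef w m)"] summable_coef
    by blast
  from summable_on_cmult_right[OF this, of "cmod a"] show ?thesis
    by (simp add: shift_def coef_Ell1 norm_mult)
qed

lemma norm_shift: "norm (shift n a w) = cmod a * norm w"
  using infsum_reindex_bij_betw[OF bij_diff[of n], of "\<lambda>m. cmod (coef w m)"]
  by (simp add: norm_ell1_def coef_shift norm_mult infsum_cmult_right')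

text \<open>A sum of translates taken in the Banach space itself: the norm bound is then the
  triangle inequality, and the coefficient formula follows by continuity of
  \<open>coef\<close>.\<close>

definition conv :: "'a::ab_group_add ell1 \<Rightarrow> 'a ell1 \<Rightarrow> 'a ell1" where
  "conv w z = (\<Sum>\<^sub>\<infinity>n. shift n (coef z n) w)"

lemma abs_summable_shift: "(\<lambda>n. shift n (coef z n) w) abs_summable_on UNIV"
  by (simp add: norm_shift summable_coef summable_on_cmult_left)

lemma summable_shift: "(\<lambda>n. shift n (coef z n) w) summable_on UNIV"
  by (rule abs_summable_summable) (rule abs_summable_shift)

lemma norm_conv_le: "norm (conv w z) \<le> norm w * norm z"
proof -
  have "norm (conv w z) \<le> (\<Sum>\<^sub>\<infinity>n. norm (shift n (coef z n) w))"
    unfolding conv_def by (rule norm_infsum_bound) (rule abs_summable_shift)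
  also have "\<dots> = norm w * norm z"
    by (simp add: norm_shift infsum_cmult_left' norm_ell1_def[of z])
  finally show ?thesis .
qed

interpretation conv: bounded_bilinear conv
proof
  fix w z y :: "'a ell1" and r :: real
  show "conv (w + z) y = conv w y + conv z y"
    unfolding conv_def infsum_add[OF summable_shift summable_shift, symmetric]
    by (intro arg_cong[where f = "\<lambda>f. infsum f UNIV"] ext ell1_eqI)
       (simp add: coef_simps coef_shift algebra_simps)
  show "conv w (z + y) = conv w z + conv w y"
    unfolding conv_def infsum_add[OF summable_shift summable_shift, symmetric]
    by (intro arg_cong[where f = "\<lambda>f. infsum f UNIV"] ext ell1_eqI)
       (simp add: coef_simps coef_shift algebra_simps)
  show "conv (r *\<^sub>R w) z = r *\<^sub>R conv w z"
    unfolding conv_def infsum_scaleR_right[symmetric]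
    by (intro arg_cong[where f = "\<lambda>f. infsum f UNIV"] ext ell1_eqI)
       (simp add: coef_simps coef_shift algebra_simps)
  show "conv w (r *\<^sub>R z) = r *\<^sub>R conv w z"
    unfolding conv_def infsum_scaleR_right[symmetric]
    by (intro arg_cong[where f = "\<lambda>f. infsum f UNIV"] ext ell1_eqI)
       (simp add: coef_simps coef_shift algebra_simps)
  show "\<exists>K. \<forall>w z :: 'a ell1. norm (conv w z) \<le> norm w * norm z * K"
    by (rule exI[of _ 1]) (simp add: norm_conv_le)
qed

lemma coef_conv: "coef (conv w z) m = (\<Sum>\<^sub>\<infinity>n. coef z n * coef w (m - n))"
  using infsumI[OF has_sum_bounded_linear[OF bounded_linear_coef has_sum_infsum[OF summable_shift[of z w]]],
      of m] by (simp add: conv_def coef_shift)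

lemma conv_delta: "conv w (delta n a) = shift n a w"
proof -
  have "(\<Sum>\<^sub>\<infinity>k. shift k (coef (delta n a) k) w) = (\<Sum>\<^sub>\<infinity>k\<in>{n}. shift k a w)"
    by (rule infsum_cong_neutral) (auto simp: coef_delta coef_shift coef_zero intro: ell1_eqI)
  then show ?thesis by (simp add: conv_def)
qed

text \<open>The coefficients of the complex conjugate function.\<close>

definition star :: "'a::ab_group_add ell1 \<Rightarrow> 'a ell1" where
  "star w = Ell1 (\<lambda>m. cnj (coef w (- m)))"

lemma coef_star: "coef (star w) m = cnj (coef w (- m))"
proof -
  have "(\<lambda>m. cmod (coef w (- m))) summable_on UNIV"
    using summable_on_reindex_bij_betw[OF bij_uminus_group, of "\<lambda>m. cmod (coef w m)"] summable_coef
    by blast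
  then show ?thesis by (simp add: star_def coef_Ell1)
qed

lemma norm_star: "norm (star w) = norm w"
  using infsum_reindex_bij_betw[OF bij_uminus_group, of "\<lambda>m. cmod (coef w m)"]
  by (simp add: norm_ell1_def coef_star)

lemma star_diff: "star w - star z = star (w - z)"
  by (rule ell1_eqI) (simp add: coef_minus coef_star)

lemma bounded_linear_star: "bounded_linear star"
  by (rule bounded_linear_intro[of _ 1])
     (auto intro!: ell1_eqI simp: coef_simps coef_star norm_star)

section \<open>Absolutely convergent Fourier series on the torus\<close>

text \<open>The offset \<open>\<theta>\<close> lets one map serve periodic functions
  (\<open>\<theta> = 0\<close>) and quasi-periodic ones (\<open>\<theta> = P j t\<close>).\<close>

definition ev :: "real ^ 2 \<Rightarrow> (int ^ 2) ell1 \<Rightarrow> real ^ 2 \<Rightarrow> complex" where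
  "ev \<theta> w x = (\<Sum>\<^sub>\<infinity>m. coef w m * cis ((rvec m + \<theta>) \<bullet> x))"

lemma rvec_simps:
  "rvec (m + n) = rvec m + rvec n" "rvec (m - n) = rvec m - rvec n" "rvec (- m) = - rvec m"
  "rvec 0 = 0" "rvec m $ s = real_of_int (m $ s)"
  by (simp_all add: rvec_def vec_eq_iff)

lemma norm_cis_minus_1_le: "cmod (cis y - 1) \<le> \<bar>y\<bar>"
proof -
  have "(cmod (cis y - 1))\<^sup>2 = 4 * (sin (y / 2))\<^sup>2"
    using cos_double_sin[of "y / 2"] sin_cos_squared_add[of y]
    by (simp add: cmod_power2 cis.sel power2_diff algebra_simps)
  also have "\<dots> \<le> 4 * \<bar>y / 2\<bar>\<^sup>2"
    by (intro mult_left_mono power2_le_iff_abs_le[THEN iffD2] power_mono)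
       (use abs_sin_x_le_abs_x[of "y / 2"] in \<open>auto simp: power2_abs\<close>)
  also have "\<dots> = \<bar>y\<bar>\<^sup>2" by (simp add: power_divide)
  finally show ?thesis by (rule power2_le_imp_le) simp
qed

lemma ev_summable: "(\<lambda>m. coef w m * cis ((rvec m + \<theta>) \<bullet> x)) summable_on UNIV"
  by (rule abs_summable_summable) (simp add: norm_mult summable_coef)

lemma norm_ev_le: "cmod (ev \<theta> w x) \<le> norm w"
proof -
  have "cmod (ev \<theta> w x) \<le> (\<Sum>\<^sub>\<infinity>m. cmod (coef w m * cis ((rvec m + \<theta>) \<bullet> x)))"
    unfolding ev_def by (rule norm_infsum_bound) (simp add: norm_mult summable_coef)
  then show ?thesis by (simp add: norm_mult norm_ell1_def)
qed

lemma ev_add: "ev \<theta> (w + z) x = ev \<theta> w x + ev \<theta> z x"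
  unfolding ev_def infsum_add[OF ev_summable ev_summable, symmetric]
  by (simp add: coef_simps algebra_simps)

lemma ev_scaleR: "ev \<theta> (r *\<^sub>R w) x = r *\<^sub>R ev \<theta> w x"
  unfolding ev_def infsum_scaleR_right[symmetric] by (simp add: coef_simps algebra_simps)

lemma ev_cscale: "ev \<theta> (cscale a w) x = a * ev \<theta> w x"
  unfolding ev_def infsum_cmult_right'[symmetric] by (simp add: coef_cscale algebra_simps)

lemma ev_diff: "ev \<theta> (w - z) x = ev \<theta> w x - ev \<theta> z x"
  using ev_add[of \<theta> "w - z" z x] by simp

lemma bounded_linear_ev: "bounded_linear (\<lambda>w. ev \<theta> w x)"
  by (rule bounded_linear_intro[of _ 1]) (auto simp: ev_add ev_scaleR norm_ev_le)

lemma ev_delta: "ev \<theta> (delta n a) x = a * cis ((rvec n + \<theta>) \<bullet> x)"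
proof -
  have "ev \<theta> (delta n a) x = (\<Sum>\<^sub>\<infinity>m\<in>{n}. a * cis ((rvec m + \<theta>) \<bullet> x))"
    unfolding ev_def by (rule infsum_cong_neutral) (auto simp: coef_delta)
  then show ?thesis by simp
qed

lemma ev_shift_frequency: "ev \<theta> w x = cis (\<theta> \<bullet> x) * ev 0 w x"
  unfolding ev_def infsum_cmult_right'[symmetric]
  by (rule infsum_cong) (simp add: inner_add_left flip: cis_mult)

lemma shift_delta: "shift n a (delta k b) = delta (n + k) (a * b)"
  by (rule ell1_eqI) (auto simp: coef_shift coef_delta algebra_simps)

text \<open>Multiplicativity of characters, extended from point masses in one argument at a time.
  Quasi-momenta add, so only one factor carries the offset.\<close>

lemma ev_conv: "ev \<theta> (conv w z) x = ev 0 w x * ev \<theta> z x"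
proof -
  have delta: "ev \<theta> (conv w (delta n a)) x = ev 0 w x * ev \<theta> (delta n a) x" for n a
  proof (rule bounded_linear_eq_on_deltas[of "\<lambda>w. ev \<theta> (conv w (delta n a)) x"])
    show "bounded_linear (\<lambda>w. ev \<theta> (conv w (delta n a)) x)"
      by (rule bounded_linear_compose[OF bounded_linear_ev conv.bounded_linear_left])
    show "bounded_linear (\<lambda>w. ev 0 w x * ev \<theta> (delta n a) x)"
      by (rule bounded_linear_compose[OF bounded_linear_mult_left bounded_linear_ev])
  qed (simp add: conv_delta shift_delta ev_delta rvec_simps inner_add_left ac_simps flip: cis_mult)
  show ?thesis
  proof (rule bounded_linear_eq_on_deltas[of "\<lambda>z. ev \<theta> (conv w z) x"])
    show "bounded_linear (\<lambda>z. ev \<theta> (conv w z) x)"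
      by (rule bounded_linear_compose[OF bounded_linear_ev conv.bounded_linear_right])
    show "bounded_linear (\<lambda>z. ev 0 w x * ev \<theta> z x)"
      by (rule bounded_linear_compose[OF bounded_linear_mult_right bounded_linear_ev])
  qed (rule delta)
qed

lemma star_delta: "star (delta n a) = delta (- n) (cnj a)"
  by (rule ell1_eqI) (auto simp: coef_star coef_delta)

lemma ev_star: "ev 0 (star w) x = cnj (ev 0 w x)"
proof (rule bounded_linear_eq_on_deltas[of "\<lambda>w. ev 0 (star w) x"])
  show "bounded_linear (\<lambda>w. ev 0 (star w) x)"
    by (rule bounded_linear_compose[OF bounded_linear_ev bounded_linear_star])
  show "bounded_linear (\<lambda>w. cnj (ev 0 w x))"
    by (rule bounded_linear_compose[OF bounded_linear_cnj bounded_linear_ev])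
qed (simp add: star_delta ev_delta rvec_simps cis_cnj)

lemma continuous_on_ev: "continuous_on S (ev \<theta> w)"
proof (rule uniform_limit_theorem)
  show "uniform_limit S (\<lambda>F x. \<Sum>m\<in>F. coef w m * cis ((rvec m + \<theta>) \<bullet> x)) (ev \<theta> w)
    (finite_subsets_at_top UNIV)"
    unfolding ev_def
    by (rule Weierstrass_m_test_general[where M = "\<lambda>m. cmod (coef w m)"])
       (auto simp: norm_mult summable_coef)
qed (auto intro!: always_eventually continuous_intros)

section \<open>Termwise differentiation\<close>

lemma has_vector_derivative_at_iff_quotient:
  "(f has_vector_derivative D) (at (0::real)) \<longleftrightarrow> ((\<lambda>h. (f h - f 0) /\<^sub>R h) \<longlongrightarrow> D) (at 0)"
proof -
  have "(f has_vector_derivative D) (at 0) \<longleftrightarrow> (\<lambda>h. norm (f h - f 0 - h *\<^sub>R D) / norm h) \<midarrow>0\<rightarrow> 0"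
    by (simp add: has_vector_derivative_def has_derivative_at bounded_linear_scaleR_left)
  also have "\<dots> \<longleftrightarrow> (\<lambda>h. norm ((f h - f 0) /\<^sub>R h - D)) \<midarrow>0\<rightarrow> 0"
  proof (rule tendsto_cong)
    have "norm (f h - f 0 - h *\<^sub>R D) / norm h = norm ((f h - f 0) /\<^sub>R h - D)" if "h \<noteq> 0" for h
    proof -
      have "(f h - f 0) /\<^sub>R h - D = (f h - f 0 - h *\<^sub>R D) /\<^sub>R h"
        using that by (simp add: scaleR_diff_right)
      then show ?thesis by (simp add: divide_inverse_commute)
    qed
    then show "\<forall>\<^sub>F h in at 0. norm (f h - f 0 - h *\<^sub>R D) / norm h = norm ((f h - f 0) /\<^sub>R h - D)"
      by (simp add: eventually_at_filter)
  qed
  finally show ?thesis by (simp add: tendsto_norm_zero_iff LIM_zero_iff)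
qed

text \<open>The difference quotient of each mode is at most \<open>cmod (coef dw m)\<close>,
  uniformly in the increment, so the M-test allows the limit to be taken termwise. The summability
  needed for this is hidden in the type of \<open>dw\<close>.\<close>

lemma has_vector_derivative_ev:
  assumes dw: "\<And>m. coef dw m = \<i> * of_real (real_of_int (m $ s) + \<theta> $ s) * coef w m"
  shows "((\<lambda>h. ev \<theta> w (x + h *\<^sub>R axis s 1)) has_vector_derivative ev \<theta> dw x) (at 0)"
proof -
  let ?a = "\<lambda>m. real_of_int (m $ s) + \<theta> $ s"
  let ?e = "\<lambda>m. cis ((rvec m + \<theta>) \<bullet> x)"
  let ?q = "\<lambda>m h. (coef w m * ?e m) * ((cis (h * ?a m) - 1) /\<^sub>R h)"
  have lim1: "((\<lambda>h. (cis (h * a) - 1) /\<^sub>R h) \<longlongrightarrow> \<i> * of_real a) (at 0)" for a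
  proof -
    have "((\<lambda>h. cis (h * a)) has_vector_derivative \<i> * of_real a) (at 0)"
      unfolding has_vector_derivative_def
      by (auto intro!: derivative_eq_intros simp: scaleR_conv_of_real)
    then show ?thesis by (simp add: has_vector_derivative_at_iff_quotient)
  qed
  have "((\<lambda>h. \<Sum>\<^sub>\<infinity>m. ?q m h) \<longlongrightarrow> ev \<theta> dw x) (at 0)"
  proof (rule swap_uniform_limit)
    show "uniform_limit UNIV (\<lambda>F h. \<Sum>m\<in>F. ?q m h) (\<lambda>h. \<Sum>\<^sub>\<infinity>m. ?q m h) (finite_subsets_at_top UNIV)"
    proof (rule Weierstrass_m_test_general[where M = "\<lambda>m. cmod (coef dw m)"])
      fix m and h :: real
      have "cmod ((cis (h * ?a m) - 1) /\<^sub>R h) \<le> \<bar>?a m\<bar>"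
      \<comment> \<open>The M-test is run over all real \<open>h\<close>; at \<open>h = 0\<close>
        the quotient is 0 because \<open>inverse 0 = 0\<close>.\<close>
      proof (cases "h = 0")
        case False
        have "cmod ((cis (h * ?a m) - 1) /\<^sub>R h) = cmod (cis (h * ?a m) - 1) / \<bar>h\<bar>"
          by (simp add: divide_inverse_commute)
        also have "\<dots> \<le> \<bar>?a m\<bar>"
          using False norm_cis_minus_1_le[of "h * ?a m"]
          by (simp add: pos_divide_le_eq abs_mult mult.commute)
        finally show ?thesis .
      qed simp
      then have "cmod (coef w m) * cmod ((cis (h * ?a m) - 1) /\<^sub>R h) \<le> cmod (coef w m) * \<bar>?a m\<bar>"
        by (rule mult_left_mono) simp
      then show "cmod (?q m h) \<le> cmod (coef dw m)" 
        by (simp only: dw norm_mult norm_of_real norm_ii norm_cis mult_1 mult_1_right mult.commute)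
    qed (rule summable_coef)
    show "((\<lambda>F. \<Sum>m\<in>F. coef dw m * ?e m) \<longlongrightarrow> ev \<theta> dw x) (finite_subsets_at_top UNIV)"
      unfolding ev_def by (rule infsum_tendsto) (rule ev_summable)
    show "\<forall>\<^sub>F F in finite_subsets_at_top UNIV. ((\<lambda>h. \<Sum>m\<in>F. ?q m h) \<longlongrightarrow> (\<Sum>m\<in>F. coef dw m * ?e m)) (at 0)"
    proof (intro always_eventually allI tendsto_sum)
      fix m
      have "((\<lambda>h. ?q m h) \<longlongrightarrow> coef w m * ?e m * (\<i> * of_real (?a m))) (at 0)"
        by (rule tendsto_mult_left[OF lim1])
      then show "((\<lambda>h. ?q m h) \<longlongrightarrow> coef dw m * ?e m) (at 0)" by (simp add: dw ac_simps)
    qed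
  qed simp
  moreover have "(\<Sum>\<^sub>\<infinity>m. ?q m h) = (ev \<theta> w (x + h *\<^sub>R axis s 1) - ev \<theta> w x) /\<^sub>R h" for h
  proof -
    have "?q m h = (coef w m * cis ((rvec m + \<theta>) \<bullet> (x + h *\<^sub>R axis s 1)) - coef w m * ?e m) /\<^sub>R h" for m
      by (simp add: inner_add_right inner_axis rvec_simps algebra_simps flip: cis_mult)
    then have "(\<Sum>\<^sub>\<infinity>m. ?q m h) = (\<Sum>\<^sub>\<infinity>m. (coef w m * cis ((rvec m + \<theta>) \<bullet> (x + h *\<^sub>R axis s 1)) - coef w m * ?e m) /\<^sub>R h)"
      by (simp only:)
    also have "\<dots> = (\<Sum>\<^sub>\<infinity>m. coef w m * cis ((rvec m + \<theta>) \<bullet> (x + h *\<^sub>R axis s 1)) + - (coef w m * ?e m)) /\<^sub>R h"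
      by (simp only: infsum_scaleR_right diff_conv_add_uminus)
    also have "(\<Sum>\<^sub>\<infinity>m. coef w m * cis ((rvec m + \<theta>) \<bullet> (x + h *\<^sub>R axis s 1)) + - (coef w m * ?e m)) =
       ev \<theta> w (x + h *\<^sub>R axis s 1) + - ev \<theta> w x"
      unfolding ev_def
      by (subst infsum_add) (auto simp: infsum_uminus ev_summable summable_on_uminus)
    finally show ?thesis by simp
  qed
  ultimately have "((\<lambda>h. (ev \<theta> w (x + h *\<^sub>R axis s 1) - ev \<theta> w x) /\<^sub>R h) \<longlongrightarrow> ev \<theta> dw x) (at 0)"
    by simp
  then show ?thesis
    by (simp add: has_vector_derivative_at_iff_quotient)
qed


lemma pdiff_cmult_ev:
  assumes "\<And>m. coef dw m = \<i> * of_real (real_of_int (m $ s) + \<theta> $ s) * coef w m"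
  shows "pdiff s (\<lambda>x. a * ev \<theta> w x) = (\<lambda>x. a * ev \<theta> dw x)"
    and "(\<lambda>h. a * ev \<theta> w (x + h *\<^sub>R axis s 1)) differentiable (at 0)"
proof -
  have d: "((\<lambda>h. a * ev \<theta> w (x + h *\<^sub>R axis s 1)) has_vector_derivative a * ev \<theta> dw x) (at 0)" for x
    by (rule has_vector_derivative_mult_right[OF has_vector_derivative_ev[OF assms]])
  then show "pdiff s (\<lambda>x. a * ev \<theta> w x) = (\<lambda>x. a * ev \<theta> dw x)"
    by (auto simp: pdiff_def fun_eq_iff intro!: vector_derivative_at)
  show "(\<lambda>h. a * ev \<theta> w (x + h *\<^sub>R axis s 1)) differentiable (at 0)"
    using d[of x] by (auto simp: differentiable_def has_vector_derivative_def)
qed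

lemma cis_period: "cis ((rvec m + \<theta>) \<bullet> (x + (2 * pi) *\<^sub>R axis s 1)) =
    cis (2 * pi * \<theta> $ s) * cis ((rvec m + \<theta>) \<bullet> x)"
proof -
  have "cis (2 * pi * real_of_int (m $ s)) = 1" by (rule cis_multiple_2pi) simp
  moreover have "(rvec m + \<theta>) \<bullet> (x + (2 * pi) *\<^sub>R axis s 1) =
      (2 * pi * \<theta> $ s + (rvec m + \<theta>) \<bullet> x) + 2 * pi * real_of_int (m $ s)"
    by (simp add: inner_add_right inner_axis rvec_simps algebra_simps)
  ultimately show ?thesis by (simp flip: cis_mult)
qed

lemma ev_period: "ev \<theta> w (x + (2 * pi) *\<^sub>R axis s 1) = cis (2 * pi * \<theta> $ s) * ev \<theta> w x"
  unfolding ev_def infsum_cmult_right'[symmetric]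
  by (rule infsum_cong) (simp only: cis_period mult.left_commute)

section \<open>Orthogonality of characters and Fourier coefficients\<close>

lemma integral_cis_period:
  assumes "a \<in> \<int>"
  shows "((\<lambda>t. cis (a * t)) has_integral (if a = 0 then 2 * pi else 0)) {0..2 * pi}"
proof (cases "a = 0")
  case True
  then show ?thesis
    using has_integral_const_real[of "1 :: complex" 0 "2 * pi"] by (simp add: scaleR_conv_of_real)
next
  case False
  have "((\<lambda>t. cis (a * t)) has_integral (cis (a * (2 * pi)) / (\<i> * a) - cis (a * 0) / (\<i> * a))) {0..2 * pi}"
  proof (rule fundamental_theorem_of_calculus)
    fix t
    have "((\<lambda>t. cis (a * t)) has_vector_derivative a *\<^sub>R (\<i> * cis (a * t))) (at t within {0..2 * pi})"
      unfolding has_vector_derivative_def by (auto intro!: derivative_eq_intros)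
    from has_vector_derivative_divide[OF this, of "\<i> * a"]
    show "((\<lambda>t. cis (a * t) / (\<i> * a)) has_vector_derivative cis (a * t)) (at t within {0..2 * pi})"
      using False by (simp add: scaleR_conv_of_real)
  qed simp
  moreover have "cis (a * (2 * pi)) = 1"
    using cis_multiple_2pi[OF assms] by (simp add: ac_simps)
  ultimately show ?thesis using False by simp
qed

text \<open>Both the character and the indicator of the box are products over the coordinates, so
  the integral factors by Fubini.\<close>

lemma has_integral_cis_cbox:
  fixes k :: "'a::euclidean_space"
  shows "((\<lambda>x. cis (k \<bullet> x)) has_integral (\<Prod>b\<in>Basis. integral {l \<bullet> b..u \<bullet> b} (\<lambda>t. cis ((k \<bullet> b) * t)))) (cbox l u)"
proof -
  interpret prod: product_sigma_finite "\<lambda>_::'a. interval_measure (\<lambda>x. x)"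
    by (intro product_sigma_finite.intro sigma_finite_interval_measure) auto
  let ?g = "\<lambda>b t. indicator {l \<bullet> b..u \<bullet> b} t *\<^sub>R cis ((k \<bullet> b) * t)"
  let ?F = "\<lambda>x. indicator (cbox l u) x *\<^sub>R cis (k \<bullet> x)"
  have F: "?F x = (\<Prod>b\<in>Basis. ?g b (x \<bullet> b))" for x
  proof -
    have "cis (\<Sum>b\<in>S. f b) = (\<Prod>b\<in>S. cis (f b))" for f :: "'a \<Rightarrow> real" and S
      by (induction S rule: infinite_finite_induct) (simp_all flip: cis_mult)
    moreover have "k \<bullet> x = (\<Sum>b\<in>Basis. (k \<bullet> b) * (x \<bullet> b))" by (rule euclidean_inner)
    moreover have "complex_of_real (indicator (cbox l u) x) = (\<Prod>b\<in>Basis. complex_of_real (indicator {l \<bullet> b..u \<bullet> b} (x \<bullet> b)))"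
      by (auto simp: indicator_def cbox_def intro!: prod_zero)
    ultimately show ?thesis by (simp add: scaleR_conv_of_real prod.distrib)
  qed
  have g: "integrable lborel (?g b)" for b
    by (rule borel_integrable_compact) (auto intro!: continuous_intros)
  have gint: "integral\<^sup>L lborel (?g b) = integral {l \<bullet> b..u \<bullet> b} (\<lambda>t. cis ((k \<bullet> b) * t))" for b
    using set_borel_integral_eq_integral(2)[of "{l \<bullet> b..u \<bullet> b}" "\<lambda>t. cis ((k \<bullet> b) * t)"] g[of b]
    by (simp add: set_integrable_def set_lebesgue_integral_def)
  have Fi: "integrable lborel ?F"
    by (rule borel_integrable_compact) (auto intro!: continuous_intros)
  \<comment> \<open>\<open>lborel_def\<close> presents Lebesgue measure as the image of a product of
    one-dimensional measures under the basis expansion.\<close>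
  have "integral\<^sup>L lborel ?F = (\<integral>f. ?F (\<Sum>b\<in>Basis. f b *\<^sub>R b) \<partial>(\<Pi>\<^sub>M b\<in>(Basis::'a set). interval_measure (\<lambda>x. x)))"
    unfolding lborel_def by (rule integral_distr) (use borel_measurable_integrable[OF Fi] in auto)
  also have "\<dots> = (\<integral>f. (\<Prod>b\<in>Basis. ?g b (f b)) \<partial>(\<Pi>\<^sub>M b\<in>(Basis::'a set). interval_measure (\<lambda>x. x)))"
    by (simp only: F) (simp cong: prod.cong)
  also have "\<dots> = (\<Prod>b\<in>Basis. integral\<^sup>L (interval_measure (\<lambda>x. x)) (?g b))"
    by (rule prod.product_integral_prod) (use g in \<open>auto simp: lborel_eq_real\<close>)
  also have "\<dots> = (\<Prod>b\<in>Basis. integral {l \<bullet> b..u \<bullet> b} (\<lambda>t. cis ((k \<bullet> b) * t)))"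
    by (simp add: gint flip: lborel_eq_real)
  finally have "(?F has_integral (\<Prod>b\<in>Basis. integral {l \<bullet> b..u \<bullet> b} (\<lambda>t. cis ((k \<bullet> b) * t)))) UNIV"
    using has_integral_integral_lborel[OF Fi] by simp
  also have "?F = (\<lambda>x. if x \<in> cbox l u then cis (k \<bullet> x) else 0)"
    by (auto simp: fun_eq_iff)
  finally show ?thesis by (simp add: has_integral_restrict_UNIV)
qed

lemma has_integral_character:
  "((\<lambda>x. cis (rvec m \<bullet> x)) has_integral (if m = 0 then (2 * pi)\<^sup>2 else 0)) torus_box"
proof -
  have "integral {0..2 * pi} (\<lambda>t. cis ((rvec m $ i) * t)) = (if m $ i = 0 then 2 * pi else 0)" for i
    using integral_unique[OF integral_cis_period[of "rvec m $ i"]] by (simp add: rvec_simps)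
  moreover have Basis_range: "Basis = range (\<lambda>i::2. axis i (1::real))"
    by (auto simp: Basis_vec_def)
  ultimately have "(\<Prod>b\<in>Basis. integral {0 \<bullet> b..(\<chi> i. 2 * pi) \<bullet> b} (\<lambda>t. cis ((rvec m \<bullet> b) * t))) =
     (\<Prod>b\<in>range (\<lambda>i::2. axis i (1::real)). (if \<exists>i. b = axis i 1 \<and> m $ i = 0 then complex_of_real (2 * pi) else 0))"
    unfolding Basis_range by (intro prod.cong refl) (auto simp: inner_axis axis_eq_axis)
  also have "\<dots> = (\<Prod>i\<in>UNIV. if m $ i = 0 then complex_of_real (2 * pi) else 0)"
    by (subst prod.reindex) (auto simp: inj_def axis_eq_axis intro!: prod.cong)
  also have "\<dots> = (if m = 0 then (2 * pi)\<^sup>2 else 0)"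
    by (simp add: UNIV_2 vec_eq_iff forall_2 power2_eq_square)
  finally show ?thesis
    using has_integral_cis_cbox[of "rvec m" 0 "\<chi> i. 2 * pi"] by (simp add: torus_box_def)
qed

text \<open>Obtained by integrating the trivial character in two ways.\<close>

lemma measure_torus_box: "measure lborel torus_box = (2 * pi)\<^sup>2"
proof -
  have "((\<lambda>x. cis (rvec 0 \<bullet> x)) has_integral measure lborel torus_box *\<^sub>R 1) torus_box"
    using has_integral_const[of "1 :: complex" 0 "(\<chi> i. 2 * pi) :: real ^ 2"]
    by (simp add: torus_box_def rvec_simps)
  from has_integral_unique[OF this has_integral_character]
  have "complex_of_real (measure lborel torus_box) = complex_of_real ((2 * pi)\<^sup>2)"
    by (simp add: scaleR_conv_of_real)
  then show ?thesis by (rule of_real_eq_iff[THEN iffD1])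
qed

lemma continuous_integrable_torus:
  fixes f :: "real ^ 2 \<Rightarrow> complex"
  shows "continuous_on UNIV f \<Longrightarrow> f integrable_on torus_box"
  unfolding torus_box_def by (rule integrable_continuous) (rule continuous_on_subset, auto)

lemma fourier_integrable: "(\<lambda>x. ev \<theta> w x * cis (k \<bullet> x)) integrable_on torus_box"
  by (rule continuous_integrable_torus) (intro continuous_intros continuous_on_ev)

text \<open>On point masses this is orthogonality of characters, and both sides are bounded
  functionals. It also makes \<open>ev 0\<close> injective, which is how identities of functions
  return to coefficients.\<close>

lemma fourier_coeff_ev: "fourier_coeff (ev 0 w) n = coef w n"
proof (rule bounded_linear_eq_on_deltas[of "\<lambda>w. fourier_coeff (ev 0 w) n"])
  let ?c = "complex_of_real ((2 * pi)\<^sup>2)"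
  show "bounded_linear (\<lambda>w. fourier_coeff (ev 0 w) n)"
  proof (rule bounded_linear_intro[of _ 1])
    fix w z :: "(int ^ 2) ell1" and r :: real
    note int = fourier_integrable[of 0 _ "- rvec n", simplified]
    show "fourier_coeff (ev 0 (w + z)) n = fourier_coeff (ev 0 w) n + fourier_coeff (ev 0 z) n"
      by (simp add: fourier_coeff_def ev_add distrib_right Henstock_Kurzweil_Integration.integral_add int add_divide_distrib)
    show "fourier_coeff (ev 0 (r *\<^sub>R w)) n = r *\<^sub>R fourier_coeff (ev 0 w) n"
      by (simp add: fourier_coeff_def ev_scaleR) (simp add: scaleR_conv_of_real)
    have "cmod (integral torus_box (\<lambda>x. ev 0 w x * cis (- (rvec n \<bullet> x)))) \<le> norm w * measure lborel torus_box"
      unfolding torus_box_def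
      by (rule has_integral_bound[OF _ integrable_integral])
         (use int in \<open>auto simp: torus_box_def norm_mult norm_ev_le\<close>)
    then show "cmod (fourier_coeff (ev 0 w) n) \<le> norm w * 1"
      by (simp add: fourier_coeff_def norm_divide measure_torus_box norm_mult norm_power pos_divide_le_eq)
  qed
  show "bounded_linear (\<lambda>w. coef w n)" by (rule bounded_linear_coef)
  fix m a
  have "(\<lambda>x. ev 0 (delta m a) x * cis (- (rvec n \<bullet> x))) = (\<lambda>x. a * cis (rvec (m - n) \<bullet> x))"
    by (simp add: ev_delta rvec_simps inner_diff_left cis_mult fun_eq_iff ac_simps)
  then show "fourier_coeff (ev 0 (delta m a)) n = coef (delta m a) n"
    using integral_unique[OF has_integral_character[of "m - n"]]
    by (simp add: fourier_coeff_def coef_delta)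
qed

lemma star_norm_ev: "star_norm (ev 0 w) = ennreal (norm w)"
proof -
  have "(\<Sum>\<^sub>\<infinity>m. ennreal (cmod (coef w m))) = (SUP F\<in>{F. finite F \<and> F \<subseteq> UNIV}. ennreal (\<Sum>m\<in>F. cmod (coef w m)))"
    by (subst nonneg_infsum_complete) (auto simp: sum_ennreal)
  also have "\<dots> = ennreal (norm w)"
    unfolding norm_ell1_def
    by (rule infsum_nonneg_is_SUPREMUM_ennreal[symmetric]) (auto simp: summable_coef)
  finally show ?thesis by (simp add: star_norm_def fourier_coeff_ev)
qed

section \<open>The two-by-two model\<close>

text \<open>Equal ranges give \<open>E ** F = F\<close> and \<open>F ** E = E\<close>; the adjoint
  of the first identity is \<open>F ** E = F\<close>. This is what the \<open>THE\<close> in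
  \<open>spectral_proj\<close> needs.\<close>

lemma orth_proj_onto_unique:
  assumes "orth_proj_onto U E" "orth_proj_onto U F"
  shows "E = F"
proof -
  have mult: "A ** B = B" if A: "orth_proj_onto U A" and B: "orth_proj_onto U B" for A B
  proof -
    have "A *v (B *v y) = B *v y" for y
    proof -
      have "B *v y \<in> range (\<lambda>y. A *v y)" using A B by (auto simp: orth_proj_onto_def)
      then obtain z where z: "B *v y = A *v z" by auto
      have "A *v (A *v z) = (A ** A) *v z" by (simp add: matrix_vector_mul_assoc)
      then show ?thesis using A z by (simp add: orth_proj_onto_def)
    qed
    then show ?thesis by (simp add: matrix_eq matrix_vector_mul_assoc[symmetric])
  qed
  have herm: "E $ a $ b = cnj (E $ b $ a)" "F $ a $ b = cnj (F $ b $ a)" for a b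
    using assms unfolding orth_proj_onto_def by blast+
  have "F $ a $ b = E $ a $ b" for a b
  proof -
    have "F $ a $ b = cnj ((E ** F) $ b $ a)" using mult[OF assms] herm(2)[of a b] by simp
    also have "\<dots> = (\<Sum>k\<in>UNIV. cnj (E $ b $ k) * cnj (F $ k $ a))"
      by (simp add: matrix_matrix_mult_def)
    also have "\<dots> = (\<Sum>k\<in>UNIV. F $ a $ k * E $ k $ b)"
      by (simp add: herm[symmetric] mult.commute)
    also have "\<dots> = (F ** E) $ a $ b" by (simp add: matrix_matrix_mult_def)
    finally show ?thesis using mult[OF assms(2,1)] by simp
  qed
  then show ?thesis by (simp add: vec_eq_iff)
qed

text \<open>The matrix claimed is the product of the unit column (c, d) with its adjoint. Since
  \<open>v \<noteq> 0\<close>, the first row of the eigenvalue equation alone determines the ratio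
  of the two components, so the eigenspace is a line.\<close>

lemma spectral_proj_rank_one:
  fixes c d \<mu> \<alpha> \<beta> v :: complex
  assumes M: "M = vector [vector [\<alpha>, v], vector [cnj v, \<beta>]]"
    and v: "v \<noteq> 0"
    and unit: "c * cnj c + d * cnj d = 1"
    and eig: "\<alpha> * c + v * d = \<mu> * c" "cnj v * c + \<beta> * d = \<mu> * d"
  shows "spectral_proj M \<mu> = vector [vector [c * cnj c, c * cnj d], vector [d * cnj c, d * cnj d]]"
    (is "_ = ?E")
proof -
  have Ey: "?E *v y = (c' * y $ 1 + d' * y $ 2) *s vector [c, d]"
    if "c' = cnj c" "d' = cnj d" for y c' d'
    by (simp add: that vec_eq_iff forall_2 matrix_vector_mult_def sum_2 vector_2 algebra_simps)
  have Mx: "M *v y = vector [\<alpha> * y $ 1 + v * y $ 2, cnj v * y $ 1 + \<beta> * y $ 2]" for y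
    by (simp add: M vec_eq_iff forall_2 matrix_vector_mult_def sum_2 vector_2)
  have proj: "orth_proj_onto {y. M *v y = \<mu> *s y} ?E"
    unfolding orth_proj_onto_def
  proof (intro conjI allI)
    have "c * cnj c * (c * cnj c) + c * cnj d * (d * cnj c) = c * cnj c"
      "c * cnj c * (c * cnj d) + c * cnj d * (d * cnj d) = c * cnj d"
      "d * cnj c * (c * cnj c) + d * cnj d * (d * cnj c) = d * cnj c"
      "d * cnj c * (c * cnj d) + d * cnj d * (d * cnj d) = d * cnj d"
      using unit by algebra+
    then show "?E ** ?E = ?E"
      by (simp only: vec_eq_iff forall_2 matrix_matrix_mult_def sum_2 vector_2 vec_lambda_beta simp_thms)
    show "?E $ a $ b = cnj (?E $ b $ a)" for a b
      using exhaust_2[of a] exhaust_2[of b] by (auto simp: vector_2)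
    show "range (\<lambda>y. ?E *v y) = {y. M *v y = \<mu> *s y}"
    proof (intro equalityI subsetI)
      fix y assume "y \<in> range (\<lambda>y. ?E *v y)"
      then obtain z where z: "y = ?E *v z" by blast
      obtain k where y: "y = k *s vector [c, d]" unfolding z Ey[OF refl refl] by blast
      have "\<alpha> * (k * c) + v * (k * d) = \<mu> * (k * c)" "cnj v * (k * c) + \<beta> * (k * d) = \<mu> * (k * d)"
        using eig by algebra+
      then have "M *v y = \<mu> *s y"
        by (simp only: Mx y vec_eq_iff forall_2 vector_2 vector_smult_component simp_thms)
      then show "y \<in> {y. M *v y = \<mu> *s y}" by simp
    next
      fix y assume "y \<in> {y. M *v y = \<mu> *s y}"
      then have "\<alpha> * y $ 1 + v * y $ 2 = \<mu> * y $ 1" by (simp add: Mx vec_eq_iff forall_2 vector_2)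
      with eig(1) have "v * (c * y $ 2) = v * (d * y $ 1)" by algebra
      then have par: "c * y $ 2 = d * y $ 1" using v by simp
      have "c * (cnj c * y $ 1 + cnj d * y $ 2) = (c * cnj c + d * cnj d) * y $ 1"
        "d * (cnj c * y $ 1 + cnj d * y $ 2) = (c * cnj c + d * cnj d) * y $ 2"
        using par by algebra+
      then have "?E *v y = y"
        by (simp only: Ey[OF refl refl] vec_eq_iff forall_2 vector_2 vector_smult_component
            mult.commute[of _ c] mult.commute[of _ d] unit mult_1 simp_thms)
      then show "y \<in> range (\<lambda>y. ?E *v y)" by (metis rangeI)
    qed
  qed
  show ?thesis
    unfolding spectral_proj_def
    by (rule the_equality, rule proj, rule orth_proj_onto_unique[OF _ proj])
qed

text \<open>With \<open>h = \<surd>(4|v|\<^sup>2 + (\<alpha> - \<beta>)\<^sup>2)\<close>, the eigenvectors are given by an angle \<open>\<theta>\<close>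
  with \<open>|v| = h cos \<theta> sin \<theta>\<close> and \<open>\<alpha> - \<beta> = s h (cos\<^sup>2 \<theta> - sin\<^sup>2 \<theta>)\<close>; below \<open>C = cos \<theta>\<close>, \<open>S = sin \<theta>\<close>.\<close>

lemma hermitian_2x2_eigenbasis:
  fixes v :: complex and \<alpha> \<beta> s :: real
  assumes v: "v \<noteq> 0" and s: "s \<in> {1, -1}"
  defines "h \<equiv> sqrt (4 * (cmod v)\<^sup>2 + (\<alpha> - \<beta>)\<^sup>2)"
  defines "\<mu> \<equiv> (\<alpha> + \<beta>) / 2 + s * (h / 2)" and "\<mu>' \<equiv> (\<alpha> + \<beta>) / 2 + (- s) * (h / 2)"
  obtains c :: real and d :: complex
  where "c\<^sup>2 + (cmod d)\<^sup>2 = 1"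
    "\<alpha> * c + v * d = \<mu> * c" "cnj v * c + \<beta> * d = \<mu> * d"
    "\<alpha> * (- cnj d) + v * c = \<mu>' * (- cnj d)" "cnj v * (- cnj d) + \<beta> * c = \<mu>' * c"
proof -
  have h2: "h\<^sup>2 = 4 * (cmod v)\<^sup>2 + (\<alpha> - \<beta>)\<^sup>2" by (simp add: h_def)
  have h: "h > 0" using v by (simp add: h_def add_pos_nonneg)
  have s2: "s * s = 1" using s by auto
  \<comment> \<open>\<open>x\<close> is the cosine of twice the angle, and \<open>C\<close>,
    \<open>S\<close> come from the half-angle formulas.\<close>
  define x where "x = s * (\<alpha> - \<beta>) / h"
  have x2: "x\<^sup>2 = (\<alpha> - \<beta>)\<^sup>2 / h\<^sup>2"
    using s by (auto simp: x_def power_divide power_mult_distrib)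
  also have "(\<alpha> - \<beta>)\<^sup>2 \<le> h\<^sup>2" by (simp add: h2)
  then have "(\<alpha> - \<beta>)\<^sup>2 / h\<^sup>2 \<le> 1" using h by simp
  finally have "\<bar>x\<bar> \<le> 1" by (simp add: abs_square_le_1)
  define C S where "C = sqrt ((1 + x) / 2)" and "S = sqrt ((1 - x) / 2)"
  have C2: "C\<^sup>2 = (1 + x) / 2" and S2: "S\<^sup>2 = (1 - x) / 2"
    using \<open>\<bar>x\<bar> \<le> 1\<close> by (auto simp: C_def S_def)
  have nonneg: "C \<ge> 0" "S \<ge> 0" using \<open>\<bar>x\<bar> \<le> 1\<close> by (auto simp: C_def S_def)
  have CS: "C * C + S * S = 1" using C2 S2 by (simp add: power2_eq_square field_simps)
  have diff: "\<alpha> - \<beta> = s * h * (C * C - S * S)"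
  proof -
    have "C * C - S * S = x" using C2 S2 by (simp add: power2_eq_square field_simps)
    moreover have "s * h * x = (s * s) * (\<alpha> - \<beta>)" using h by (simp add: x_def)
    ultimately show ?thesis using s2 by simp
  qed
  have vCS: "cmod v = h * C * S"
  proof (rule power2_eq_imp_eq)
    have "(h * C * S)\<^sup>2 = h\<^sup>2 * ((1 + x) / 2) * ((1 - x) / 2)" by (simp add: power_mult_distrib C2 S2)
    also have "\<dots> = (h\<^sup>2 - h\<^sup>2 * x\<^sup>2) / 4" by (simp add: power2_eq_square field_simps)
    also have "h\<^sup>2 * x\<^sup>2 = (\<alpha> - \<beta>)\<^sup>2" using h by (simp add: x2)
    also have "(h\<^sup>2 - (\<alpha> - \<beta>)\<^sup>2) / 4 = (cmod v)\<^sup>2" by (simp add: h2)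
    finally show "(cmod v)\<^sup>2 = (h * C * S)\<^sup>2" by simp
  qed (use h nonneg in auto)
  \<comment> \<open>The phase of \<open>v\<close> is put entirely into \<open>d\<close>, which keeps
    the first component real.\<close>
  define g where "g = sgn v"
  have g: "g * cnj g = 1" using v by (simp add: g_def complex_norm_square[symmetric] norm_sgn)
  have vg: "v = of_real (h * C * S) * g"
    using v by (simp add: g_def sgn_div_norm vCS[symmetric] scaleR_conv_of_real)
  have cvg: "cnj v = of_real (h * C * S) * cnj g" by (subst vg) simp
  define d where "d = of_real (s * S) * cnj g"
  have cd: "cnj d = of_real (s * S) * g" by (simp add: d_def)
  have a: "\<alpha> = (\<alpha> + \<beta>) / 2 + s * h * (C * C - S * S) / 2" "\<beta> = (\<alpha> + \<beta>) / 2 - s * h * (C * C - S * S) / 2"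
    using diff by (simp_all add: field_simps)
  \<comment> \<open>In \<open>a\<close> both entries recur on the right-hand sides, so unfolding
    would loop; naming their mean removes this.\<close>
  define k where "k = (\<alpha> + \<beta>) / 2"
  have ab: "\<alpha> = k + s * h * (C * C - S * S) / 2" "\<beta> = k - s * h * (C * C - S * S) / 2"
    using a by (simp_all add: k_def)
  have m: "\<mu> = k + s * h / 2" "\<mu>' = k - s * h / 2" by (simp_all add: \<mu>_def \<mu>'_def k_def)
  have CSc: "complex_of_real C * C + complex_of_real S * S = 1"
    using arg_cong[OF CS, of complex_of_real] by simp
  have s2c: "complex_of_real s * s = 1" using arg_cong[OF s2, of complex_of_real] by simp
  show ?thesis
  proof (rule that[of C d])
    have "(cmod d)\<^sup>2 = S\<^sup>2"
      using s v by (auto simp: d_def norm_mult g_def norm_sgn)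
    then show "C\<^sup>2 + (cmod d)\<^sup>2 = 1" using CS by (simp add: power2_eq_square)
    show "\<alpha> * C + v * d = \<mu> * C"
      unfolding ab m vg d_def using CSc s2c g by (simp add: field_simps) algebra
    show "cnj v * C + \<beta> * d = \<mu> * d"
      unfolding ab m cvg d_def using CSc s2c g by (simp add: field_simps) algebra
    show "\<alpha> * (- cnj d) + v * C = \<mu>' * (- cnj d)"
      unfolding ab m cd unfolding vg using CSc s2c g by (simp add: field_simps) algebra
    show "cnj v * (- cnj d) + \<beta> * C = \<mu>' * C"
      unfolding ab m cvg cd using CSc s2c g by (simp add: field_simps) algebra
  qed
qed

section \<open>The contraction\<close>

lemma dmul_diff:
  assumes "\<And>m. cmod (r m) \<le> B"
  shows "dmul r w - dmul r z = dmul r (w - z)"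
  by (rule ell1_eqI) (simp add: coef_minus coef_dmul[OF assms] algebra_simps)

lemma cscale_diff: "cscale a w - cscale a z = cscale a (w - z)"
  unfolding cscale_def by (rule dmul_diff) (rule order_refl)

lemma cscale_diff_left: "cscale a w - cscale b w = cscale (a - b) w"
  by (rule ell1_eqI) (simp add: coef_minus coef_cscale algebra_simps)

text \<open>The coefficients of |W|^2 W, where W = \<open>ev 0 w\<close>.\<close>

definition cube :: "'a::ab_group_add ell1 \<Rightarrow> 'a ell1" where
  "cube w = conv (conv w (star w)) w"

lemma norm_cube_le: "norm (cube w) \<le> norm w ^ 3"
proof -
  have "norm (cube w) \<le> (norm w * norm (star w)) * norm w"
    unfolding cube_def
    by (rule order_trans[OF norm_conv_le]) (intro mult_right_mono norm_conv_le norm_ge_zero)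
  then show ?thesis by (simp add: norm_star power3_eq_cube)
qed

text \<open>The difference telescopes over the three factors; each of the three terms has one factor
  \<open>w - z\<close> and two factors of norm at most \<open>R\<close>.\<close>

lemma norm_cube_diff_le:
  assumes w: "norm w \<le> R" and z: "norm z \<le> R"
  shows "norm (cube w - cube z) \<le> 3 * R\<^sup>2 * norm (w - z)"
proof -
  have R: "R \<ge> 0" using norm_ge_zero[of w] w by linarith
  have eq: "cube w - cube z =
      conv (conv (w - z) (star w)) w + conv (conv z (star (w - z))) w + conv (conv z (star z)) (w - z)"
    by (simp add: cube_def conv.diff_left conv.diff_right flip: star_diff)
  have bound: "norm (conv (conv a b) c) \<le> norm a * norm b * norm c" for a b c :: "'a ell1"
    by (rule order_trans[OF norm_conv_le]) (intro mult_right_mono norm_conv_le norm_ge_zero)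
  have "norm (conv (conv (w - z) (star w)) w) \<le> norm (w - z) * R * R"
    by (rule order_trans[OF bound]) (use w R in \<open>auto simp: norm_star intro!: mult_mono\<close>)
  moreover have "norm (conv (conv z (star (w - z))) w) \<le> R * norm (w - z) * R"
    by (rule order_trans[OF bound]) (use w z R in \<open>auto simp: norm_star intro!: mult_mono\<close>)
  moreover have "norm (conv (conv z (star z)) (w - z)) \<le> R * R * norm (w - z)"
    by (rule order_trans[OF bound]) (use z R in \<open>auto simp: norm_star intro!: mult_mono\<close>)
  moreover have "norm (w - z) * R * R + R * norm (w - z) * R + R * R * norm (w - z) = 3 * R\<^sup>2 * norm (w - z)"
    by (simp add: power2_eq_square)
  ultimately show ?thesis
    unfolding eq using norm_triangle_ineq norm_triangle_le
    by (smt (verit, best))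
qed

text \<open>Absence of 2-torsion keeps \<open>q\<close> and \<open>- q\<close> apart.\<close>

lemma int_vec_double_zero:
  fixes q :: "int ^ 'n"
  shows "q + q = 0 \<longleftrightarrow> q = 0"
  by (auto simp: vec_eq_iff)

lemma conv_two_deltas: "coef (conv w (delta m a + delta n b)) k = a * coef w (k - m) + b * coef w (k - n)"
  by (simp add: conv.add_right conv_delta coef_plus coef_shift)

lemma star_two_deltas: "star (delta m a + delta n b) = delta (- m) (cnj a) + delta (- n) (cnj b)"
  by (rule ell1_eqI) (auto simp: coef_star coef_plus coef_delta)

text \<open>\<open>conv e (star e)\<close> lives on \<open>- q\<close>, \<open>0\<close>,
  \<open>q\<close> with value 1 at \<open>0\<close>, so few products reach the block. This is the
  exact evaluation that yields the factor 1/2 in the bound of the correction along the second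
  eigenvector.\<close>

lemma coef_cube_two_deltas:
  fixes q :: "int ^ 2"
  assumes q: "q \<noteq> 0" and unit: "c * cnj c + d * cnj d = 1"
  defines "e \<equiv> delta 0 c + delta (- q) d"
  shows "coef (cube e) 0 = c * (1 + d * cnj d)" "coef (cube e) (- q) = d * (1 + c * cnj c)"
proof -
  have ne: "q + q \<noteq> 0" "- q \<noteq> q" "q \<noteq> - q" "- q - q \<noteq> 0" "- q - q \<noteq> - q"
    using q int_vec_double_zero[of q] by (auto simp: eq_neg_iff_add_eq_0 diff_eq_eq neg_eq_iff_add_eq_0)
  have e: "coef e m = (if m = 0 then c else if m = - q then d else 0)" for m
    using q by (simp add: e_def coef_plus coef_delta)
  have z: "coef (conv e (star e)) k = cnj c * coef e k + cnj d * coef e (k - q)" for k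
    using conv_two_deltas[of e 0 "cnj c" q "cnj d" k] by (simp add: e_def star_two_deltas)
  have cube: "coef (cube e) k = c * coef (conv e (star e)) k + d * coef (conv e (star e)) (k + q)" for k
    using conv_two_deltas[of "conv e (star e)" 0 c "- q" d k] by (simp add: cube_def e_def)
  have "coef (cube e) 0 = c * (c * cnj c + d * cnj d) + d * (c * cnj d)"
    using q ne by (simp add: cube z e algebra_simps)
  then show "coef (cube e) 0 = c * (1 + d * cnj d)" using unit by (simp add: algebra_simps)
  have "coef (cube e) (- q) = c * (d * cnj c) + d * (c * cnj c + d * cnj d)"
    using q ne by (simp add: cube z e algebra_simps)
  then show "coef (cube e) (- q) = d * (1 + c * cnj c)" using unit by (simp add: algebra_simps)
qed

text \<open>Reduction to the block \<open>{0, - q}\<close>, spanned by the orthonormal eigenvectors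
  \<open>e = (c, d)\<close> and \<open>f = (- cnj d, c)\<close>. Writing the solution as \<open>e + S y\<close>, where \<open>S\<close> scales the modes outside
  the block by \<open>\<epsilon>\<^sup>2\<close>, makes the equation a contraction for \<open>y\<close>: the coupling
  through \<open>V\<close> is of size \<open>\<epsilon>\<^sup>9\<close> against a gap \<open>\<epsilon>\<^sup>6\<close> outside the block, and returns
  to the block as \<open>\<epsilon>\<^sup>9 \<epsilon>\<^sup>2\<close> against the gap \<open>2\<epsilon>\<^sup>1\<^sup>0\<close>. The component of the
  equation along \<open>e\<close> determines the eigenvalue shift \<open>\<delta>\<close>.\<close>

lemma perturbed_block_solution:
  fixes V :: "(int ^ 2) ell1" and D :: "int ^ 2 \<Rightarrow> real" and c \<tau> \<mu> \<mu>' \<epsilon> :: real and d :: complex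
  assumes q: "q \<noteq> 0" and \<epsilon>: "0 < \<epsilon>" "\<epsilon> \<le> 1 / 2000"
    and V: "norm V \<le> \<epsilon> ^ 9" "coef V 0 = 0"
    and \<tau>: "\<bar>\<tau>\<bar> \<le> \<epsilon> ^ 11"
    and unit: "c\<^sup>2 + (cmod d)\<^sup>2 = 1"
    and eig_e: "D 0 * c + coef V q * d = \<mu> * c" "coef V (- q) * c + D (- q) * d = \<mu> * d"
    and eig_f: "D 0 * (- cnj d) + coef V q * c = \<mu>' * (- cnj d)"
      "coef V (- q) * (- cnj d) + D (- q) * c = \<mu>' * c"
    and gap: "\<And>m. m \<noteq> 0 \<Longrightarrow> m \<noteq> - q \<Longrightarrow> \<bar>D m - \<mu>\<bar> \<ge> \<epsilon> ^ 6 / 4" "\<bar>\<mu> - \<mu>'\<bar> \<ge> 2 * \<epsilon> ^ 10"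
  obtains w \<phi> :: "(int ^ 2) ell1" and \<delta> :: complex where
    "w = delta 0 c + delta (- q) d + \<phi>" "norm \<phi> \<le> \<epsilon>" "cmod \<delta> \<le> 17 * \<epsilon> ^ 11"
    "\<forall>m. D m * coef w m + coef (conv V w) m + \<tau> * coef (cube w) m = (\<mu> + \<delta>) * coef w m"
proof -
  have "q \<noteq> - q" and qnz: "- q \<noteq> 0" "0 \<noteq> - q" using q int_vec_double_zero[of q] by (auto simp: eq_neg_iff_add_eq_0)
  have [simp]: "0 \<le> \<epsilon>" "\<epsilon> \<noteq> 0" using \<epsilon> by auto
  have e11: "\<epsilon> ^ 11 = \<epsilon>\<^sup>2 * \<epsilon> ^ 9" "\<epsilon> ^ 11 = \<epsilon> * \<epsilon> ^ 10" and pos: "\<epsilon> ^ n > 0" for n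
    using \<epsilon> by (auto simp: power_add[symmetric] power_Suc[symmetric])
  have "\<epsilon>\<^sup>2 \<le> (1 / 2000)\<^sup>2" using \<epsilon> by (intro power_mono) auto
  then have "\<epsilon>\<^sup>2 * \<epsilon> ^ 9 \<le> (1 / 2000)\<^sup>2 * \<epsilon> ^ 9" using pos[of 9] by (intro mult_right_mono) auto
  then have small: "\<epsilon>\<^sup>2 \<le> 1" "100 * \<epsilon> ^ 11 \<le> \<epsilon> ^ 9"
    using \<open>\<epsilon>\<^sup>2 \<le> _\<close> pos[of 9] unfolding e11(1) by (auto simp: power2_eq_square)
  have c1: "\<bar>c\<bar> \<le> 1" and d1: "cmod d \<le> 1"
  proof -
    have "c\<^sup>2 \<le> 1" "(cmod d)\<^sup>2 \<le> 1" using unit zero_le_power2[of c] zero_le_power2[of "cmod d"] by linarith+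
    then show "\<bar>c\<bar> \<le> 1" "cmod d \<le> 1" using abs_square_le_1[of c] abs_square_le_1[of "cmod d"] by auto
  qed
  \<comment> \<open>3/2 is a rational substitute for the square root of 2, the largest possible
    value for a unit vector.\<close>
  have cd: "\<bar>c\<bar> + cmod d \<le> 3 / 2" and cd2: "2 * (\<bar>c\<bar> * cmod d) \<le> 1"
  proof -
    have "0 \<le> (\<bar>c\<bar> - cmod d)\<^sup>2" by simp
    then show "2 * (\<bar>c\<bar> * cmod d) \<le> 1" using unit by (simp add: power2_diff)
    then have "(\<bar>c\<bar> + cmod d)\<^sup>2 \<le> (3 / 2)\<^sup>2" using unit by (simp add: power2_sum power_divide)
    then show "\<bar>c\<bar> + cmod d \<le> 3 / 2" by (rule power2_le_imp_le) simp
  qed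
  have unitc: "c * cnj c + d * cnj d = 1"
    using arg_cong[OF unit, of complex_of_real]
    by (simp only: of_real_add complex_norm_square of_real_1) (simp add: power2_eq_square)
  have unitc': "of_real c * of_real c + d * cnj d = 1" using unitc by simp
  define e f where "e = delta 0 (of_real c) + delta (- q) d"
    and "f = delta 0 (- cnj d) + delta (- q) (of_real c)"
  have e: "coef e m = (if m = 0 then of_real c else if m = - q then d else 0)" for m
    using q by (simp add: e_def coef_plus coef_delta)
  have f: "coef f m = (if m = 0 then - cnj d else if m = - q then of_real c else 0)" for m
    using q by (simp add: f_def coef_plus coef_delta)
  have norm_e: "norm e \<le> 3 / 2" and norm_f: "norm f \<le> 3 / 2"
    using norm_triangle_ineq[of "delta 0 (of_real c)" "delta (- q) d"]
      norm_triangle_ineq[of "delta 0 (- cnj d)" "delta (- q) (of_real c)"] cd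
    unfolding e_def f_def norm_delta complex_mod_cnj norm_minus_cancel norm_of_real by linarith+
  \<comment> \<open>Hermitian inner products of the block part of \<open>g\<close> with
    \<open>e\<close> and \<open>f\<close>; \<open>decomp\<close> is the resulting orthonormal
    expansion.\<close>
  define ipe ipf where "ipe g = c * coef g 0 + cnj d * coef g (- q)"
    and "ipf g = - d * coef g 0 + c * coef g (- q)" for g
  have ip_diff: "ipe g - ipe h = ipe (g - h)" "ipf g - ipf h = ipf (g - h)" for g h
    by (simp_all add: ipe_def ipf_def coef_minus algebra_simps)
  have ip_norm: "cmod (ipe g) \<le> norm g" "cmod (ipf g) \<le> norm g" for g
  proof -
    have le: "cmod (a * coef g 0 + b * coef g (- q)) \<le> norm g" if "cmod a \<le> 1" "cmod b \<le> 1" for a b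
    proof -
      have "cmod (a * coef g 0 + b * coef g (- q)) \<le> cmod a * cmod (coef g 0) + cmod b * cmod (coef g (- q))"
        by (rule norm_triangle_le) (simp add: norm_mult)
      also have "\<dots> \<le> 1 * cmod (coef g 0) + 1 * cmod (coef g (- q))"
        using that by (intro add_mono mult_right_mono) auto
      finally show ?thesis using norm_coef2_le[OF qnz(2), of g] by simp
    qed
    show "cmod (ipe g) \<le> norm g" unfolding ipe_def by (rule le) (use c1 d1 in auto)
    show "cmod (ipf g) \<le> norm g" unfolding ipf_def by (rule le) (use c1 d1 in auto)
  qed
  have decomp: "c * ipe g - cnj d * ipf g = coef g 0" "d * ipe g + c * ipf g = coef g (- q)" for g
    using unitc' unfolding ipe_def ipf_def by algebra+
  define B :: "(int ^ 2) set" where "B = {0, - q}"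
  \<comment> \<open>\<open>off\<close> removes the block. Outside it \<open>r\<close> contains the
    extra factor 1/\<epsilon>^2 that \<open>sc\<close> undoes: \<open>sc m * r m\<close> is the
    plain inverse of \<open>\<mu> - D m\<close>.\<close>
  define sc where "sc m = (if m \<in> B then 1 else complex_of_real (\<epsilon>\<^sup>2))" for m
  define r where "r m = (if m \<in> B then 0 else - 1 / complex_of_real (\<epsilon>\<^sup>2 * (D m - \<mu>)))" for m
  define off where "off m = (if m \<in> B then 0 else 1 :: complex)" for m
  have sc1: "cmod (sc m) \<le> 1" for m using small by (simp add: sc_def norm_power)
  have off1: "cmod (off m) \<le> 1" for m by (simp add: off_def)
  have off_sc: "cmod (off m * sc m) \<le> \<epsilon>\<^sup>2" for m using \<epsilon> by (simp add: off_def sc_def norm_power)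
  have gapr: "0 < \<bar>D m - \<mu>\<bar>" "1 / \<bar>D m - \<mu>\<bar> \<le> 4 / \<epsilon> ^ 6" if "m \<notin> B" for m
  proof -
    have le: "\<bar>D m - \<mu>\<bar> \<ge> \<epsilon> ^ 6 / 4" using gap(1)[of m] that by (auto simp: B_def)
    then show gt: "0 < \<bar>D m - \<mu>\<bar>" using pos[of 6] by linarith
    have "1 / \<bar>D m - \<mu>\<bar> \<le> 1 / (\<epsilon> ^ 6 / 4)" 
      using le pos[of 6] gt by (intro divide_left_mono mult_pos_pos) auto
    then show "1 / \<bar>D m - \<mu>\<bar> \<le> 4 / \<epsilon> ^ 6" by simp
  qed
  have r_bound: "cmod (r m) \<le> 4 / \<epsilon> ^ 8" for m
  proof (cases "m \<in> B")
    case False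
    have "cmod (r m) = (1 / \<epsilon>\<^sup>2) * (1 / \<bar>D m - \<mu>\<bar>)"
      using False \<epsilon> by (simp add: r_def norm_divide norm_mult norm_power flip: of_real_diff)
    also have "\<dots> \<le> (1 / \<epsilon>\<^sup>2) * (4 / \<epsilon> ^ 6)" by (rule mult_left_mono[OF gapr(2)[OF False]]) simp
    also have "\<dots> = 4 / \<epsilon> ^ 8" by (simp add: power_add[symmetric])
    finally show ?thesis .
  qed (use \<epsilon> in \<open>simp add: r_def\<close>)
  have sc_r: "cmod (sc m * r m) \<le> 4 / \<epsilon> ^ 6" for m
    using gapr[of m] \<epsilon> by (cases "m \<in> B") (auto simp: sc_def r_def norm_divide norm_mult norm_power simp flip: of_real_diff)

  define S where "S = dmul sc"
  define N where "N y = cscale (of_real \<tau>) (cube (e + S y))" for y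
  \<comment> \<open>With \<open>w = e + S y\<close>, \<open>gB\<close> is what the model matrix does
    not account for in the block equation: \<open>V\<close> acting on the outer modes, and the cubic
    term. The correction is normalized to have no component along \<open>e\<close>, so the
    \<open>e\<close> component of the equation reads \<delta> = \<open>L y\<close>.
    \<open>LS\<close> is the shift times the correction, \<open>K\<close> the source for the outer
    modes, and \<open>\<kappa>\<close> the amplitude along \<open>f\<close>, where the gap
    \<open>\<mu> - \<mu>'\<close> is divided out.\<close>
  define gB where "gB y = conv V (dmul off (S y)) + N y" for y
  define L where "L y = ipe (gB y)" for y
  define LS where "LS y = cscale (L y) (S y)" for y
  define K where "K y = (conv V (e + S y) + N y) - LS y" for y
  define h where "h y = gB y - LS y" for y
  define \<kappa> where "\<kappa> y = ipf (h y) / of_real (\<mu> - \<mu>')" for y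
  define T where "T y = dmul r (K y) + cscale (\<kappa> y) f" for y

  have coef_S: "coef (S y) m = sc m * coef y m" for y m
    unfolding S_def by (rule coef_dmul[OF sc1])
  have S_diff: "S y - S z = S (y - z)" for y z unfolding S_def by (rule dmul_diff[OF sc1])
  have norm_S: "norm (S y) \<le> norm y" for y
    unfolding S_def using norm_dmul_le[of sc 1 y] sc1 by simp
  have offS: "dmul off (S y) = dmul (\<lambda>m. off m * sc m) y" for y
    by (rule ell1_eqI) (simp add: coef_dmul[OF off1] coef_dmul[OF off_sc] coef_S)
  have norm_offS: "norm (conv V (dmul off (S y))) \<le> \<epsilon> ^ 11 * norm y" for y
  proof -
    have "norm (conv V (dmul off (S y))) \<le> \<epsilon> ^ 9 * (\<epsilon>\<^sup>2 * norm y)"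
      unfolding offS
      by (rule order_trans[OF norm_conv_le]) (intro mult_mono V norm_dmul_le[OF off_sc]; use \<epsilon> in simp)
    then show ?thesis unfolding e11(1) by (simp only: ac_simps)
  qed
  have norm_eS: "norm (e + S y) \<le> 5 / 2" if "norm y \<le> 1" for y
    using norm_triangle_ineq[of e "S y"] norm_e norm_S[of y] that by linarith
  \<comment> \<open>Origin of the constants on the unit ball: (5/2)^3 < 16 and 3 (5/2)^2 < 19 for
    the cubic term; one more for the return through \<open>V\<close> gives 17 and 20; then 37 = 20 +
    17, 57 = 20 + 37, 56 = 19 + 37. Finally 43 rounds up 57 * 3/4, and 51 = 8 + 43.\<close>
  have N_bound: "norm (N y) \<le> 16 * \<epsilon> ^ 11" if "norm y \<le> 1" for y
  proof -
    have "norm (cube (e + S y)) \<le> (5 / 2) ^ 3"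
      by (rule order_trans[OF norm_cube_le]) (intro power_mono norm_eS that norm_ge_zero)
    also have "\<dots> \<le> 16" by (simp add: power_divide)
    finally have "\<bar>\<tau>\<bar> * norm (cube (e + S y)) \<le> \<epsilon> ^ 11 * 16"
      using \<tau> by (intro mult_mono) auto
    then show ?thesis by (simp add: N_def norm_cscale)
  qed
  have N_lip: "norm (N y - N z) \<le> 19 * \<epsilon> ^ 11 * norm (y - z)" if "norm y \<le> 1" "norm z \<le> 1" for y z
  proof -
    have "norm (cube (e + S y) - cube (e + S z)) \<le> 3 * (5 / 2)\<^sup>2 * norm ((e + S y) - (e + S z))"
      by (rule norm_cube_diff_le) (intro norm_eS that)+
    also have "\<dots> = 75 / 4 * norm (S (y - z))" by (simp add: S_diff power_divide)
    also have "\<dots> \<le> 19 * norm (y - z)"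
      using norm_S[of "y - z"] norm_ge_zero[of "y - z"] by linarith
    finally have "\<bar>\<tau>\<bar> * norm (cube (e + S y) - cube (e + S z)) \<le> \<epsilon> ^ 11 * (19 * norm (y - z))"
      using \<tau> by (intro mult_mono) auto
    then show ?thesis by (simp add: N_def cscale_diff norm_cscale)
  qed
  have gB_bound: "norm (gB y) \<le> 17 * \<epsilon> ^ 11" if "norm y \<le> 1" for y
  proof -
    have "\<epsilon> ^ 11 * norm y \<le> \<epsilon> ^ 11 * 1" using that pos[of 11] by (intro mult_left_mono) auto
    then show ?thesis
      unfolding gB_def using norm_offS[of y] N_bound[OF that]
        norm_triangle_ineq[of "conv V (dmul off (S y))" "N y"] by linarith
  qed
  have gB_lip: "norm (gB y - gB z) \<le> 20 * \<epsilon> ^ 11 * norm (y - z)" if "norm y \<le> 1" "norm z \<le> 1" for y z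
  proof -
    have eq: "gB y - gB z = conv V (dmul off (S (y - z))) + (N y - N z)"
      by (simp add: gB_def conv.diff_right flip: S_diff dmul_diff[OF off1])
    show ?thesis
      unfolding eq using norm_offS[of "y - z"] N_lip[OF that]
        norm_triangle_ineq[of "conv V (dmul off (S (y - z)))" "N y - N z"] by linarith
  qed
  have L_bound: "cmod (L y) \<le> 17 * \<epsilon> ^ 11" if "norm y \<le> 1" for y
    unfolding L_def using ip_norm(1)[of "gB y"] gB_bound[OF that] by linarith
  have L_lip: "cmod (L y - L z) \<le> 20 * \<epsilon> ^ 11 * norm (y - z)" if "norm y \<le> 1" "norm z \<le> 1" for y z
    unfolding L_def ip_diff using ip_norm(1)[of "gB y - gB z"] gB_lip[OF that] by linarith
  have LS_lip: "norm (LS y - LS z) \<le> 37 * \<epsilon> ^ 11 * norm (y - z)" if "norm y \<le> 1" "norm z \<le> 1" for y z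
  proof -
    have eq: "LS y - LS z = cscale (L y - L z) (S y) + cscale (L z) (S (y - z))"
      by (simp add: LS_def cscale_diff_left[symmetric] cscale_diff[symmetric] S_diff[symmetric])
    have "cmod (L y - L z) * norm (S y) \<le> (20 * \<epsilon> ^ 11 * norm (y - z)) * 1"
      using L_lip[OF that] norm_S[of y] that pos[of 11] by (intro mult_mono) auto
    moreover have "cmod (L z) * norm (S (y - z)) \<le> 17 * \<epsilon> ^ 11 * norm (y - z)"
      using L_bound[OF that(2)] norm_S[of "y - z"] pos[of 11] by (intro mult_mono) auto
    ultimately show ?thesis
      unfolding eq
      using norm_triangle_ineq[of "cscale (L y - L z) (S y)" "cscale (L z) (S (y - z))"]
      unfolding norm_cscale by linarith
  qed
  have h_lip: "norm (h y - h z) \<le> 57 * \<epsilon> ^ 11 * norm (y - z)" if "norm y \<le> 1" "norm z \<le> 1" for y z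
  proof -
    have eq: "h y - h z = (gB y - gB z) - (LS y - LS z)" by (simp add: h_def)
    show ?thesis
      unfolding eq
      using gB_lip[OF that] LS_lip[OF that] norm_triangle_ineq4[of "gB y - gB z" "LS y - LS z"]
      by linarith
  qed
  have K_lip: "norm (K y - K z) \<le> 2 * \<epsilon> ^ 9 * norm (y - z)" if "norm y \<le> 1" "norm z \<le> 1" for y z
  proof -
    have eq: "K y - K z = conv V (S (y - z)) + (N y - N z) - (LS y - LS z)"
      by (simp add: K_def conv.diff_right conv.add_right flip: S_diff)
    have "norm (conv V (S (y - z))) \<le> \<epsilon> ^ 9 * norm (y - z)"
      by (rule order_trans[OF norm_conv_le]) (intro mult_mono V norm_S; use \<epsilon> in simp)
    then have "norm (K y - K z) \<le> \<epsilon> ^ 9 * norm (y - z) + 56 * \<epsilon> ^ 11 * norm (y - z)"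
      unfolding eq
      using N_lip[OF that] LS_lip[OF that] norm_triangle_ineq[of "conv V (S (y - z))" "N y - N z"]
        norm_triangle_ineq4[of "conv V (S (y - z)) + (N y - N z)" "LS y - LS z"]
      by linarith
    also have "\<dots> = (\<epsilon> ^ 9 + 56 * \<epsilon> ^ 11) * norm (y - z)" by (simp add: algebra_simps)
    also have "\<dots> \<le> (2 * \<epsilon> ^ 9) * norm (y - z)"
      using small pos[of 11] by (intro mult_right_mono norm_ge_zero) linarith
    finally show ?thesis .
  qed
  have S0: "S 0 = 0" by (rule ell1_eqI) (simp add: coef_S coef_zero)
  have dmul0: "dmul off 0 = 0" by (rule ell1_eqI) (simp add: coef_dmul[OF off1] coef_zero)
  have cscale0: "cscale a 0 = 0" for a :: complex by (rule ell1_eqI) (simp add: coef_cscale coef_zero)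
  have LS0: "LS 0 = 0" by (simp add: LS_def S0 cscale0)
  have K0: "norm (K 0) \<le> 2 * \<epsilon> ^ 9"
  proof -
    have "norm (conv V e) \<le> \<epsilon> ^ 9 * (3 / 2)"
      by (rule order_trans[OF norm_conv_le]) (intro mult_mono V norm_e; use \<epsilon> in simp)
    moreover have "norm (N 0) \<le> 16 * \<epsilon> ^ 11" by (rule N_bound) simp
    moreover have K0_eq: "K 0 = conv V e + N 0" by (simp add: K_def S0 LS0)
    ultimately show ?thesis
      unfolding K0_eq using norm_triangle_ineq[of "conv V e" "N 0"] small pos[of 9] by linarith
  qed
  \<comment> \<open>The only place where the general bound on \<open>N\<close> would be too weak: at
    \<open>y = 0\<close> the component along \<open>f\<close> is computed exactly, and
    \<open>2 * (\<bar>c\<bar> * cmod d) \<le> 1\<close> supplies the factor 1/2.\<close>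
  have h0: "cmod (ipf (h 0)) \<le> \<epsilon> ^ 11 / 2"
  proof -
    have "h 0 = N 0" by (simp add: h_def gB_def S0 dmul0 conv.zero_right LS0)
    moreover have "ipf (N 0) = \<tau> * (c * d * (c * cnj c - d * cnj d))"
      using coef_cube_two_deltas[OF q unitc]
      by (simp add: ipf_def N_def coef_cscale S0 e_def algebra_simps)
    moreover have "cmod (c * d * (c * cnj c - d * cnj d)) \<le> 1 / 2"
    proof -
      have "cmod (c * cnj c - d * cnj d) \<le> cmod (c * cnj c) + cmod (d * cnj d)" by (rule norm_triangle_ineq4)
      also have "\<dots> = 1" using unit by (simp add: norm_mult power2_eq_square)
      finally have "cmod (c * d) * cmod (c * cnj c - d * cnj d) \<le> (1 / 2) * 1"
        using cd2 by (intro mult_mono) (auto simp: norm_mult)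
      then show ?thesis by (simp add: norm_mult)
    qed
    ultimately show ?thesis
      using mult_mono[of "\<bar>\<tau>\<bar>" "\<epsilon> ^ 11" "cmod (c * d * (c * cnj c - d * cnj d))" "1 / 2"] \<tau> pos[of 11]
      by (simp add: norm_mult)
  qed
  \<comment> \<open>3/4 is the product of 1/2, from the gap 2 \<epsilon>^10, and 3/2, from
    \<open>norm f\<close>.\<close>
  have div_gap: "cmod a / \<bar>\<mu> - \<mu>'\<bar> * norm f \<le> (X * \<epsilon>) * (3 / 4)" if "cmod a \<le> X * \<epsilon> ^ 11" for a X
  proof -
    have "cmod a / \<bar>\<mu> - \<mu>'\<bar> \<le> X * \<epsilon> ^ 11 / (2 * \<epsilon> ^ 10)"
      by (rule frac_le) (use that gap(2) pos[of 10] order_trans[OF norm_ge_zero that] in auto)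
    also have "\<dots> = X * \<epsilon> / 2" unfolding e11(2) using \<epsilon> by simp
    finally have le: "cmod a / \<bar>\<mu> - \<mu>'\<bar> \<le> X * \<epsilon> / 2" .
    have "0 \<le> cmod a / \<bar>\<mu> - \<mu>'\<bar>" by simp
    then have "cmod a / \<bar>\<mu> - \<mu>'\<bar> * norm f \<le> (X * \<epsilon> / 2) * (3 / 2)"
      using le by (intro mult_mono norm_f norm_ge_zero) linarith+
    then show ?thesis by simp
  qed
  have \<kappa>_lip: "norm (cscale (\<kappa> y - \<kappa> z) f) \<le> 43 * \<epsilon> * norm (y - z)" if "norm y \<le> 1" "norm z \<le> 1" for y z
  proof -
    have "\<kappa> y - \<kappa> z = ipf (h y - h z) / of_real (\<mu> - \<mu>')"
      by (simp add: \<kappa>_def diff_divide_distrib flip: ip_diff)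
    then have "norm (cscale (\<kappa> y - \<kappa> z) f) = cmod (ipf (h y - h z)) / \<bar>\<mu> - \<mu>'\<bar> * norm f"
      by (simp add: norm_cscale norm_divide flip: of_real_diff)
    also have "\<dots> \<le> (57 * norm (y - z)) * \<epsilon> * (3 / 4)"
      by (rule div_gap) (use ip_norm(2)[of "h y - h z"] h_lip[OF that] in \<open>simp add: algebra_simps\<close>)
    also have "\<dots> \<le> 43 * \<epsilon> * norm (y - z)" using \<epsilon> by simp
    finally show ?thesis .
  qed
  have \<kappa>0: "norm (cscale (\<kappa> 0) f) \<le> 3 / 8 * \<epsilon>"
    using div_gap[of "ipf (h 0)" "1 / 2"] h0
    by (simp add: \<kappa>_def norm_cscale norm_divide flip: of_real_diff)
  have e9: "4 / \<epsilon> ^ 8 * (2 * \<epsilon> ^ 9 * x) = 8 * \<epsilon> * x" for x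
    using \<epsilon> by (simp add: power_numeral_reduce)
  have T_lip: "norm (T y - T z) \<le> 51 * \<epsilon> * norm (y - z)" if "norm y \<le> 1" "norm z \<le> 1" for y z
  proof -
    have eq: "T y - T z = dmul r (K y - K z) + cscale (\<kappa> y - \<kappa> z) f"
      by (simp add: T_def dmul_diff[OF r_bound, symmetric] cscale_diff_left[symmetric])
    moreover have "norm (dmul r (K y - K z)) \<le> 4 / \<epsilon> ^ 8 * (2 * \<epsilon> ^ 9 * norm (y - z))"
      by (rule order_trans[OF norm_dmul_le[OF r_bound]])
         (rule mult_left_mono[OF K_lip[OF that]], use \<epsilon> in simp)
    ultimately show ?thesis
      using \<kappa>_lip[OF that] norm_triangle_ineq[of "dmul r (K y - K z)" "cscale (\<kappa> y - \<kappa> z) f"]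
      unfolding e9 eq by linarith
  qed
  have T0: "norm (T 0) \<le> 9 * \<epsilon>"
  proof -
    have "norm (dmul r (K 0)) \<le> 4 / \<epsilon> ^ 8 * (2 * \<epsilon> ^ 9 * 1)"
      by (rule order_trans[OF norm_dmul_le[OF r_bound]]) (rule mult_left_mono, use K0 \<epsilon> in auto)
    then show ?thesis
      using \<kappa>0 norm_triangle_ineq[of "dmul r (K 0)" "cscale (\<kappa> 0) f"] \<epsilon> unfolding e9 T_def by simp
  qed
  have T_bound: "norm (T y) \<le> 9 * \<epsilon> + 51 * \<epsilon> * norm y" if "norm y \<le> 1" for y
    using T_lip[OF that, of 0] T0 norm_triangle_ineq[of "T y - T 0" "T 0"] by simp
  \<comment> \<open>The image of the unit ball has radius at most 60 \<epsilon>, and the Lipschitz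
    constant is 51 \<epsilon>, at most 1/2.\<close>
  have "\<exists>!y\<in>cball 0 1. T y = y"
  proof (rule Banach_fix[of _ "1 / 2"])
    show "T ` cball 0 1 \<subseteq> cball 0 1"
    proof (clarsimp)
      fix y :: "(int ^ 2) ell1" assume y: "norm y \<le> 1"
      have "51 * \<epsilon> * norm y \<le> 51 * \<epsilon> * 1" using y \<epsilon> by (intro mult_left_mono) auto
      then show "norm (T y) \<le> 1" using T_bound[OF y] \<epsilon> by linarith
    qed
    fix x y :: "(int ^ 2) ell1" assume xy: "x \<in> cball 0 1" "y \<in> cball 0 1"
    have "51 * \<epsilon> * norm (x - y) \<le> 1 / 2 * norm (x - y)" using \<epsilon> by (intro mult_right_mono) auto
    then show "dist (T x) (T y) \<le> 1 / 2 * dist x y"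
      using T_lip[of x y] xy by (simp add: dist_norm)
  qed (auto simp: complete_eq_closed)
  then obtain y where y: "norm y \<le> 1" and fix_y: "T y = y" by auto
  \<comment> \<open>Absorbing half of \<open>norm y\<close> in the bound 9 \<epsilon> +
    \<open>norm y\<close> / 2 improves the radius from 1 to 18 \<epsilon>.\<close>
  have norm_y: "norm y \<le> 18 * \<epsilon>"
  proof -
    have "51 * \<epsilon> * norm y \<le> 1 / 2 * norm y" using \<epsilon> by (intro mult_right_mono) auto
    then show ?thesis using T_bound[OF y] unfolding fix_y by simp
  qed
  have coef_y: "coef y m = r m * coef (K y) m + \<kappa> y * coef f m" for m
    using arg_cong[OF fix_y, of "\<lambda>y. coef y m"] by (simp add: T_def coef_plus coef_dmul[OF r_bound] coef_cscale)
  have sc_f: "sc m * coef f m = coef f m" for m by (simp add: sc_def f B_def)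
  have Sy: "S y = dmul (\<lambda>m. sc m * r m) (K y) + cscale (\<kappa> y) f"
    by (rule ell1_eqI)
       (simp add: coef_S coef_y coef_plus coef_dmul[OF sc_r] coef_cscale distrib_left mult.assoc
         mult.left_commute[of _ "\<kappa> y"] sc_f)
  \<comment> \<open>Undoing the scaling makes the outer modes O(\<epsilon>^3). Along
    \<open>f\<close> there remain 3/8 \<epsilon> from \<open>y = 0\<close> and 43 \<epsilon> * 18
    \<epsilon> from the Lipschitz bound; the latter is below 2/5 \<epsilon> for \<epsilon> at most
    1/2000.\<close>
  have norm_Sy: "norm (S y) \<le> \<epsilon>"
  proof -
    have "norm (K y) \<le> 4 * \<epsilon> ^ 9"
    proof -
      have "2 * \<epsilon> ^ 9 * norm y \<le> 2 * \<epsilon> ^ 9 * 1" using y pos[of 9] by (intro mult_left_mono) auto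
      then show ?thesis
        using K_lip[OF y, of 0] K0 norm_triangle_ineq[of "K y - K 0" "K 0"] by simp
    qed
    then have "norm (dmul (\<lambda>m. sc m * r m) (K y)) \<le> 4 / \<epsilon> ^ 6 * (4 * \<epsilon> ^ 9)"
      by (intro order_trans[OF norm_dmul_le[OF sc_r]] mult_left_mono) (use \<epsilon> in auto)
    also have "\<dots> = 16 * \<epsilon>\<^sup>2 * \<epsilon>" using \<epsilon> by (simp add: power_numeral_reduce)
    also have "\<dots> \<le> 16 * (1 / 2000)\<^sup>2 * \<epsilon>" using \<epsilon> by (intro mult_mono power_mono) auto
    finally have 1: "norm (dmul (\<lambda>m. sc m * r m) (K y)) \<le> 16 * (1 / 2000)\<^sup>2 * \<epsilon>" .
    have "43 * \<epsilon> * norm y \<le> 43 * (1 / 2000) * (18 * \<epsilon>)" using \<epsilon> norm_y by (intro mult_mono) auto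
    moreover have "cscale (\<kappa> y) f = cscale (\<kappa> y - \<kappa> 0) f + cscale (\<kappa> 0) f"
      by (simp add: cscale_diff_left[symmetric])
    ultimately have 2: "norm (cscale (\<kappa> y) f) \<le> 43 * (1 / 2000) * (18 * \<epsilon>) + 3 / 8 * \<epsilon>"
      using \<kappa>_lip[OF y, of 0] \<kappa>0 norm_triangle_ineq[of "cscale (\<kappa> y - \<kappa> 0) f" "cscale (\<kappa> 0) f"] by simp
    show ?thesis
      using 1 2 norm_triangle_ineq[of "dmul (\<lambda>m. sc m * r m) (K y)" "cscale (\<kappa> y) f"] \<epsilon>
      unfolding Sy by (simp add: power2_eq_square)
  qed
  define w where "w = e + S y"
  have conv_w: "coef (conv V w) m = of_real c * coef V m + d * coef V (m + q) + coef (conv V (S y)) m" for m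
    using conv_two_deltas[of V 0 "of_real c" "- q" d m]
    by (simp add: w_def conv.add_right coef_plus flip: e_def)
  have eqn: "D m * coef w m + coef (conv V w) m + \<tau> * coef (cube w) m = (\<mu> + L y) * coef w m" for m
  proof (cases "m \<in> B")
    case False
    then have em: "coef e m = 0" "coef f m = 0" by (auto simp: e f B_def)
    have nz: "complex_of_real (D m - \<mu>) \<noteq> 0" using gapr(1)[OF False] by auto
    have "complex_of_real (D m - \<mu>) * (sc m * r m) = - 1"
      using False \<epsilon> nz by (simp add: sc_def r_def)
    moreover have wm: "coef w m = sc m * r m * coef (K y) m"
      by (simp add: w_def coef_plus em coef_S coef_y)
    ultimately have "complex_of_real (D m - \<mu>) * coef w m = - coef (K y) m"
      by (simp only: mult.assoc[symmetric]) simp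
    moreover have "coef (K y) m = coef (conv V w) m + \<tau> * coef (cube w) m - L y * coef w m"
      by (simp add: K_def LS_def N_def w_def coef_simps coef_cscale em)
    ultimately show ?thesis by (simp add: algebra_simps)
  next
    case True
    have Sy_B: "coef (S y) 0 = - \<kappa> y * cnj d" "coef (S y) (- q) = \<kappa> y * c"
      by (simp_all add: coef_S coef_y sc_def r_def B_def f qnz q)
    \<comment> \<open>\<open>V\<close> applied to the two block modes gives the off-diagonal entries
      of the model matrix, and the eigenvalue equations for \<open>f\<close> account for these; only
      the outer modes enter \<open>gB\<close>.\<close>
    have S_split: "S y = dmul off (S y) + (delta 0 (coef (S y) 0) + delta (- q) (coef (S y) (- q)))"
      using qnz by (intro ell1_eqI) (auto simp: coef_plus coef_dmul[OF off1] coef_delta off_def B_def)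
    have conv_S: "coef (conv V (S y)) m = coef (conv V (dmul off (S y))) m
       + (coef (S y) 0 * coef V m + coef (S y) (- q) * coef V (m + q))" for m
      by (subst S_split) (simp add: conv.add_right coef_plus conv_two_deltas[of V, unfolded conv.add_right coef_plus])
    have gB_m: "coef (gB y) m = coef (conv V (dmul off (S y))) m + \<tau> * coef (cube w) m" for m
      by (simp add: gB_def N_def w_def coef_plus coef_cscale)
    have w_B: "coef w 0 = c - \<kappa> y * cnj d" "coef w (- q) = d + \<kappa> y * c"
      using qnz by (simp_all add: w_def coef_plus e Sy_B)
    \<comment> \<open>At the fixed point the block part of \<open>S y\<close> is
      \<open>\<kappa> y\<close> times the unit vector \<open>f\<close>, so its inner product with
      \<open>f\<close> is \<open>\<kappa> y\<close>. This turns the definition of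
      \<open>\<kappa>\<close> into the \<open>f\<close> component of the equation.\<close>
    have "of_real (\<mu> - \<mu>') * \<kappa> y = ipf (h y)"
      using gap(2) pos[of 10] by (auto simp: \<kappa>_def)
    also have "\<dots> = ipf (gB y) - L y * ipf (S y)"
      by (simp add: h_def LS_def ipf_def coef_minus coef_cscale algebra_simps)
    also have "ipf (S y) = (c * c + d * cnj d) * \<kappa> y" by (simp add: ipf_def Sy_B algebra_simps)
    also have "\<dots> = \<kappa> y" using unitc' by simp
    finally have ipf_gB: "ipf (gB y) = (\<mu> - \<mu>' + L y) * \<kappa> y" by (simp add: algebra_simps)
    have gB0: "coef (gB y) 0 = c * L y - cnj d * ((\<mu> - \<mu>' + L y) * \<kappa> y)"
      and gBq: "coef (gB y) (- q) = d * L y + c * ((\<mu> - \<mu>' + L y) * \<kappa> y)"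
      using decomp[of "gB y"] unfolding ipf_gB L_def[symmetric] by simp_all
    from True consider "m = 0" | "m = - q" by (auto simp: B_def)
    then show ?thesis
    proof cases
      case 1
      have "coef (conv V w) 0 + \<tau> * coef (cube w) 0 = coef (gB y) 0 + coef V q * (d + \<kappa> y * c)"
        by (simp add: conv_w conv_S gB_m V Sy_B algebra_simps)
      then have "coef (conv V w) 0 + \<tau> * coef (cube w) 0 =
         c * L y - cnj d * ((\<mu> - \<mu>' + L y) * \<kappa> y) + coef V q * (d + \<kappa> y * c)" unfolding gB0 .
      then show ?thesis 
        unfolding 1 w_B using eig_e(1) eig_f(1) unfolding of_real_mult of_real_diff by algebra
    next
      case 2
      have "coef (conv V w) (- q) + \<tau> * coef (cube w) (- q) = coef (gB y) (- q) + coef V (- q) * (c - \<kappa> y * cnj d)"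
        by (simp add: conv_w conv_S gB_m V Sy_B algebra_simps)
      then have "coef (conv V w) (- q) + \<tau> * coef (cube w) (- q) =
         d * L y + c * ((\<mu> - \<mu>' + L y) * \<kappa> y) + coef V (- q) * (c - \<kappa> y * cnj d)" unfolding gBq .
      then show ?thesis 
        unfolding 2 w_B using eig_e(2) eig_f(2) unfolding of_real_mult of_real_diff by algebra
    qed
  qed
  show ?thesis
    by (rule that[of w "S y" "L y"]) (use norm_Sy L_bound[OF y] eqn in \<open>auto simp: w_def e_def\<close>)
qed

section \<open>The resonant solution\<close>

lemma star_eq_self:
  assumes "\<And>x. ev 0 w x \<in> \<real>"
  shows "star w = w"
proof (rule ell1_eqI)
  fix m
  have "ev 0 (star w) = ev 0 w" using assms by (simp add: fun_eq_iff ev_star Reals_cnj_iff)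
  then show "coef (star w) m = coef w m" using fourier_coeff_ev by metis
qed

lemma coef_zero_real:
  assumes "\<And>x. ev 0 w x \<in> \<real>"
  shows "coef w 0 \<in> \<real>"
  using arg_cong[OF star_eq_self[OF assms], of "\<lambda>w. coef w 0"] by (simp add: coef_star Reals_cnj_iff)

text \<open>The coefficient at 0 is a mean value over the torus, so this is Parseval's identity for
  the pairing of \<open>z\<close> with \<open>w\<close>.\<close>

lemma coef_conv_star: "coef (conv (star w) z) 0 = (\<Sum>\<^sub>\<infinity>n. coef z n * cnj (coef w n))"
  by (simp add: coef_conv coef_star)

lemma pairing_summable: "(\<lambda>n. coef z n * cnj (coef w n)) summable_on UNIV"
  using abs_summable_summable[OF abs_summable_mult_bounded[of "\<lambda>n. cnj (coef w n)" "norm w" z]] norm_coef_le[of w]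
  by (simp add: mult.commute)

text \<open>Pair the equation with \<open>w\<close>; the potential and the cubic terms contribute the mean values of
  the real functions \<open>V |w|\<^sup>2\<close> and \<open>|w|\<^sup>4\<close>.\<close>

lemma nonlinear_eigenvalue_real:
  fixes D :: "int ^ 2 \<Rightarrow> real" and \<tau> :: real and \<mu> :: complex
  assumes V: "\<And>x. ev 0 V x \<in> \<real>" and w: "w \<noteq> 0"
    and eqn: "\<And>m. D m * coef w m + coef (conv V w) m + \<tau> * coef (cube w) m = \<mu> * coef w m"
  shows "\<mu> \<in> \<real>"
proof -
  \<comment> \<open>Multiplication by the unbounded \<open>D\<close> is not an operator on the whole
    space; its value at \<open>w\<close> is instead read off from the other terms of the equation,
    which are summable.\<close>
  define Dw where "Dw = cscale \<mu> w - conv V w - cscale (of_real \<tau>) (cube w)"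
  have coef_Dw: "coef Dw m = D m * coef w m" for m
    using eqn[of m] by (simp add: Dw_def coef_minus coef_cscale) (simp add: algebra_simps)
  have real_infsum: "(\<Sum>\<^sub>\<infinity>n. coef z n * cnj (coef w n)) \<in> \<real>" if "\<And>n. coef z n * cnj (coef w n) \<in> \<real>" for z
    using infsum_Im[OF pairing_summable, of z w] that by (simp add: complex_is_Real_iff)
  have sq: "coef w n * cnj (coef w n) = of_real ((cmod (coef w n))\<^sup>2)" for n
    by (simp only: complex_norm_square)
  have "coef (conv (star w) Dw) 0 \<in> \<real>"
    unfolding coef_conv_star by (rule real_infsum) (simp add: coef_Dw mult.assoc sq)
  moreover have "coef (conv (star w) (conv V w)) 0 \<in> \<real>"
  proof (rule coef_zero_real)
    fix x
    have "ev 0 (conv (star w) (conv V w)) x = ev 0 V x * of_real ((cmod (ev 0 w x))\<^sup>2)"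
      unfolding complex_norm_square by (simp add: ev_conv ev_star)
    then show "ev 0 (conv (star w) (conv V w)) x \<in> \<real>" using V by simp
  qed
  moreover have "coef (conv (star w) (cube w)) 0 \<in> \<real>"
  proof (rule coef_zero_real)
    fix x
    have "ev 0 (conv (star w) (cube w)) x = of_real ((cmod (ev 0 w x))\<^sup>2) * of_real ((cmod (ev 0 w x))\<^sup>2)"
      unfolding complex_norm_square cube_def by (simp add: ev_conv ev_star)
    then show "ev 0 (conv (star w) (cube w)) x \<in> \<real>" by simp
  qed
  moreover have "\<mu> * coef (conv (star w) w) 0 = coef (conv (star w) Dw) 0
      + coef (conv (star w) (conv V w)) 0 + \<tau> * coef (conv (star w) (cube w)) 0"
  proof -
    have lin: "coef (conv (star w) (cscale a z)) 0 = a * coef (conv (star w) z) 0" for a z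
      unfolding coef_conv_star infsum_cmult_right'[symmetric] by (simp add: coef_cscale mult.assoc)
    show ?thesis by (simp add: Dw_def conv.diff_right coef_minus lin)
  qed
  ultimately have prod: "\<mu> * coef (conv (star w) w) 0 \<in> \<real>" by simp
  have norm_real: "coef (conv (star w) w) 0 \<in> \<real>"
    unfolding coef_conv_star by (rule real_infsum) (simp add: sq)
  obtain n where n: "coef w n \<noteq> 0" using w ell1_eqI[of w 0] by (auto simp: coef_zero)
  have "(\<Sum>k\<in>{n}. Re (coef w k * cnj (coef w k))) \<le> (\<Sum>\<^sub>\<infinity>k. Re (coef w k * cnj (coef w k)))"
    by (rule finite_sum_le_infsum) (use summable_on_Re[OF pairing_summable, of w w] in \<open>auto simp: sq\<close>)
  also have "\<dots> = Re (coef (conv (star w) w) 0)"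
    unfolding coef_conv_star by (rule infsum_Re[OF pairing_summable])
  finally have "(cmod (coef w n))\<^sup>2 \<le> Re (coef (conv (star w) w) 0)" by (simp add: sq)
  moreover have "(cmod (coef w n))\<^sup>2 > 0" using n by simp
  ultimately have "Re (coef (conv (star w) w) 0) > 0" by linarith
  then have "coef (conv (star w) w) 0 \<noteq> 0" by auto
  then have "\<mu> = \<mu> * coef (conv (star w) w) 0 / coef (conv (star w) w) 0" by simp
  then show ?thesis using Reals_divide[OF prod norm_real] by simp
qed

section \<open>The potential, regularity and the spectral gap\<close>

lemma finite_lattice_ball: "finite {m :: int ^ 2. norm (rvec m) \<le> R}"
proof (rule finite_subset)
  let ?I = "{- \<lceil>R\<rceil>..\<lceil>R\<rceil>}"
  show "{m :: int ^ 2. norm (rvec m) \<le> R} \<subseteq> (\<lambda>(a, b). vector [a, b]) ` (?I \<times> ?I)"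
  proof
    fix m :: "int ^ 2" assume "m \<in> {m. norm (rvec m) \<le> R}"
    then have "\<bar>real_of_int (m $ i)\<bar> \<le> R" for i
      using component_le_norm_cart[of "rvec m" i] by (simp add: rvec_simps)
    then have "m $ i \<in> ?I" for i using le_of_int_ceiling[of R] by (smt (verit) atLeastAtMost_iff of_int_le_iff of_int_minus)
    moreover have "m = vector [m $ 1, m $ 2]" by (simp add: vec_eq_iff forall_2 vector_2)
    ultimately show "m \<in> (\<lambda>(a, b). vector [a, b]) ` (?I \<times> ?I)" by (auto intro!: image_eqI[of _ _ "(m $ 1, m $ 2)"])
  qed
qed simp

text \<open>Finiteness of the index set matters here: \<open>sum\<close> over an infinite set would
  be 0 by default.\<close>

lemma trig_poly_as_ev:
  assumes "\<And>m. v m \<noteq> 0 \<Longrightarrow> 0 < norm (rvec m) \<and> norm (rvec m) \<le> R"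
  shows "coef (Ell1 v) = v" "trig_poly R v = ev 0 (Ell1 v)"
proof -
  have fin: "finite {m. 0 < norm (rvec m) \<and> norm (rvec m) \<le> R}"
    by (rule finite_subset[OF _ finite_lattice_ball[of R]]) auto
  have "v abs_summable_on UNIV"
    by (rule finite_nonzero_values_imp_summable_on) (rule finite_subset[OF _ fin], use assms in auto)
  then show coef: "coef (Ell1 v) = v" by (rule coef_Ell1)
  show "trig_poly R v = ev 0 (Ell1 v)"
  proof
    fix x
    have "ev 0 (Ell1 v) x = (\<Sum>\<^sub>\<infinity>m\<in>{m. 0 < norm (rvec m) \<and> norm (rvec m) \<le> R}. v m * cis (rvec m \<bullet> x))"
      unfolding ev_def coef by (rule infsum_cong_neutral) (use assms in auto)
    then show "trig_poly R v x = ev 0 (Ell1 v) x" using fin by (simp add: trig_poly_def)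
  qed
qed

text \<open>Each frequency component is at most 1 + |k|^2 and each product of two at most |k|^2, so
  summability of the coefficients of \<open>w\<close> and \<open>Dw\<close> controls all derivatives
  up to order two.\<close>

lemma smooth_ev:
  assumes Dw: "\<And>m. coef Dw m = of_real ((norm (rvec m + \<theta>))\<^sup>2) * coef w m"
  shows "C2 (\<lambda>x. a * ev \<theta> w x)"
    and "laplacian (\<lambda>x. a * ev \<theta> w x) x = - (a * ev \<theta> Dw x)"
    and "quasi_periodic \<theta> (\<lambda>x. a * ev \<theta> w x)"
proof -
  let ?k = "\<lambda>m s. real_of_int (m $ s) + \<theta> $ s"
  have k_le: "\<bar>?k m s\<bar> \<le> norm (rvec m + \<theta>)" for m s
    using component_le_norm_cart[of "rvec m + \<theta>" s] by (simp add: rvec_simps)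
  define d1 where "d1 s = Ell1 (\<lambda>m. \<i> * of_real (?k m s) * coef w m)" for s
  define d2 where "d2 r s = Ell1 (\<lambda>m. \<i> * of_real (?k m r) * (\<i> * of_real (?k m s) * coef w m))" for r s
  have coef_d1: "coef (d1 s) m = \<i> * of_real (?k m s) * coef w m" for s m
  proof -
    have "(\<lambda>m. \<i> * of_real (?k m s) * coef w m) abs_summable_on UNIV"
    proof (rule Infinite_Sum.abs_summable_on_comparison_test'[of "\<lambda>m. cmod (coef w m) + cmod (coef Dw m)"])
      fix m
      have "\<bar>?k m s\<bar> \<le> 1 + (norm (rvec m + \<theta>))\<^sup>2"
      proof (cases "norm (rvec m + \<theta>) \<le> 1")
        case False
        then have "norm (rvec m + \<theta>) * 1 \<le> norm (rvec m + \<theta>) * norm (rvec m + \<theta>)"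
          by (intro mult_left_mono) auto
        then show ?thesis using k_le[of m s] by (simp add: power2_eq_square)
      qed (use k_le[of m s] zero_le_power2[of "norm (rvec m + \<theta>)"] in linarith)
      then have "\<bar>?k m s\<bar> * cmod (coef w m) \<le> (1 + (norm (rvec m + \<theta>))\<^sup>2) * cmod (coef w m)"
        by (rule mult_right_mono) simp
      then show "cmod (\<i> * of_real (?k m s) * coef w m) \<le> cmod (coef w m) + cmod (coef Dw m)"
        unfolding Dw norm_mult norm_of_real norm_ii by (simp add: distrib_right)
    qed (intro summable_on_add summable_coef)
    then show ?thesis by (simp add: d1_def coef_Ell1)
  qed
  have coef_d2: "coef (d2 r s) m = \<i> * of_real (?k m r) * coef (d1 s) m" for r s m
  proof -
    have "(\<lambda>m. \<i> * of_real (?k m r) * (\<i> * of_real (?k m s) * coef w m)) abs_summable_on UNIV"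
    proof (rule Infinite_Sum.abs_summable_on_comparison_test'[of "\<lambda>m. cmod (coef Dw m)"])
      fix m
      have "\<bar>?k m r\<bar> * \<bar>?k m s\<bar> \<le> (norm (rvec m + \<theta>))\<^sup>2"
        unfolding power2_eq_square by (intro mult_mono k_le) auto
      then have "\<bar>?k m r\<bar> * \<bar>?k m s\<bar> * cmod (coef w m) \<le> (norm (rvec m + \<theta>))\<^sup>2 * cmod (coef w m)"
        by (rule mult_right_mono) simp
      then show "cmod (\<i> * of_real (?k m r) * (\<i> * of_real (?k m s) * coef w m)) \<le> cmod (coef Dw m)"
        unfolding Dw norm_mult norm_of_real norm_ii by (simp add: mult.assoc)
    qed (rule summable_coef)
    then show ?thesis by (simp add: d2_def coef_Ell1 coef_d1)
  qed
  have p1: "pdiff s (\<lambda>x. a * ev \<theta> w x) = (\<lambda>x. a * ev \<theta> (d1 s) x)" for s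
    by (rule pdiff_cmult_ev) (rule coef_d1)
  have p2: "pdiff r (\<lambda>x. a * ev \<theta> (d1 s) x) = (\<lambda>x. a * ev \<theta> (d2 r s) x)" for r s
    by (rule pdiff_cmult_ev) (rule coef_d2)
  show "C2 (\<lambda>x. a * ev \<theta> w x)"
    unfolding C2_def has_partials_def p1 p2
    by (intro conjI allI continuous_intros continuous_on_ev pdiff_cmult_ev(2)[OF coef_d1] pdiff_cmult_ev(2)[OF coef_d2])
  have "(\<Sum>s\<in>UNIV. d2 s s) = - Dw"
  proof (rule ell1_eqI)
    fix m
    have "(norm (rvec m + \<theta>))\<^sup>2 = (\<Sum>s\<in>UNIV. ?k m s * ?k m s)"
      by (simp add: power2_norm_eq_inner inner_vec_def rvec_simps)
    then have "coef Dw m = (\<Sum>s\<in>UNIV. of_real (?k m s) * of_real (?k m s) * coef w m)"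
      unfolding Dw by (simp add: sum_distrib_right)
    then show "coef (\<Sum>s\<in>UNIV. d2 s s) m = coef (- Dw) m"
      by (simp add: sum_2 coef_plus coef_uminus coef_d2 coef_d1) (simp add: algebra_simps)
  qed
  then have "laplacian (\<lambda>x. a * ev \<theta> w x) x = a * ev \<theta> (- Dw) x"
    by (simp add: laplacian_def p1 p2 flip: sum_distrib_left bounded_linear.linear[OF bounded_linear_ev, THEN linear_sum])
  then show "laplacian (\<lambda>x. a * ev \<theta> w x) x = - (a * ev \<theta> Dw x)"
    using ev_scaleR[of \<theta> "-1" Dw x] by simp
  show "quasi_periodic \<theta> (\<lambda>x. a * ev \<theta> w x)"
    unfolding quasi_periodic_def p1 by (simp add: ev_period)
qed

text \<open>Separation holds on a circle around the eigenvalue, and one point of it suffices: moving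
  to the centre costs \<epsilon>^10 / 3, far less than \<epsilon>^6 / 2.\<close>

lemma resonant_gap:
  assumes sep: "separated v q k \<epsilon> X" and t: "t \<in> res_nbhd k \<epsilon> X" "near_res_index q k \<epsilon> X t j"
    and s: "s \<in> {1, -1}" and m: "m \<noteq> j" "m \<noteq> j - q" and \<epsilon>: "0 < \<epsilon>" "\<epsilon> \<le> 1 / 2000"
  shows "\<bar>(p m t)\<^sup>2 - model_eigenvalue s v q j t\<bar> \<ge> \<epsilon> ^ 6 / 4"
proof -
  let ?\<mu> = "model_eigenvalue s v q j t"
  have pos: "\<epsilon> ^ 6 > 0" "\<epsilon> ^ 10 \<ge> 0" using \<epsilon> by auto
  have "complex_of_real (?\<mu> + 1 / 3 * \<epsilon> ^ 10) \<in> sphere (complex_of_real ?\<mu>) (1 / 3 * \<epsilon> ^ 10)"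
    using \<epsilon> by (simp add: dist_norm norm_power)
  then have "2 * cmod (complex_of_real ((p m t)\<^sup>2) - complex_of_real (?\<mu> + 1 / 3 * \<epsilon> ^ 10)) \<ge> \<epsilon> ^ 6"
    using sep t s m unfolding separated_def by blast
  then have "2 * \<bar>(p m t)\<^sup>2 - (?\<mu> + 1 / 3 * \<epsilon> ^ 10)\<bar> \<ge> \<epsilon> ^ 6"
    by (simp only: norm_of_real flip: of_real_diff)
  moreover have "\<epsilon> ^ 10 \<le> \<epsilon> ^ 6 / 16"
  proof -
    have "\<epsilon> ^ 4 \<le> (1 / 2) ^ 4" using \<epsilon> by (intro power_mono) auto
    then have "\<epsilon> ^ 4 \<le> 1 / 16" by (simp add: power_divide)
    then have "\<epsilon> ^ 4 * \<epsilon> ^ 6 \<le> 1 / 16 * \<epsilon> ^ 6" using pos by (intro mult_right_mono) auto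
    then show ?thesis by (simp add: power_add[symmetric])
  qed
  moreover have "\<bar>(p m t)\<^sup>2 - (?\<mu> + 1 / 3 * \<epsilon> ^ 10)\<bar> \<le> \<bar>(p m t)\<^sup>2 - ?\<mu>\<bar> + 1 / 3 * \<epsilon> ^ 10"
    using abs_triangle_ineq4[of "(p m t)\<^sup>2 - ?\<mu>" "1 / 3 * \<epsilon> ^ 10"] pos by (simp add: diff_diff_eq)
  moreover have "e6 / 4 \<le> b" if "e6 \<le> 2 * a" "e10 \<le> e6 / 16" "a \<le> b + 1 / 3 * e10" "0 < e6" for a b e6 e10 :: real
    using that by linarith
  ultimately show ?thesis using pos(1) by blast
qed

lemma nonlinear_resonant_solution:
  fixes v :: "int ^ 2 \<Rightarrow> complex" and \<epsilon> \<sigma> k s :: real and A :: complex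
  assumes pot: "real_trig_potential R0 v" and q: "q \<noteq> 0" "v q \<noteq> 0"
    and \<epsilon>: "0 < \<epsilon>" "\<epsilon> \<le> 1 / 2000"
    and small: "star_norm (trig_poly R0 v) < ennreal (\<epsilon> ^ 9)" "cmod (v q) > \<epsilon> ^ 10"
      "\<bar>\<sigma>\<bar> * (cmod A)\<^sup>2 < \<epsilon> ^ 11"
    and sep: "separated v q k \<epsilon> X" and t: "t \<in> res_nbhd k \<epsilon> X" "near_res_index q k \<epsilon> X t j"
    and s: "s \<in> {1, -1}"
  shows "\<exists>(u :: real ^ 2 \<Rightarrow> complex) (lam :: real) (\<phi> :: real ^ 2 \<Rightarrow> complex).
                C2 u \<and>
                (\<forall>x\<in>torus_box.
                   - laplacian u x + trig_poly R0 v x * u x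
                     + complex_of_real \<sigma> * complex_of_real ((cmod (u x))\<^sup>2) * u x
                   = complex_of_real lam * u x) \<and>
                quasi_periodic t u \<and>
                (\<forall>x. u x = A * cis (P j t \<bullet> x) * (psi_lead s v q j t x + \<phi> x)) \<and>
                \<bar>lam - model_eigenvalue s v q j t\<bar> \<le> 17 * \<epsilon> ^ 11 \<and>
                periodic2 \<phi> \<and> continuous_on UNIV \<phi> \<and> star_norm \<phi> \<le> ennreal \<epsilon>"
proof -
  define V where "V = Ell1 v"
  have supp: "0 < norm (rvec m) \<and> norm (rvec m) \<le> R0" if "v m \<noteq> 0" for m
    using pot that unfolding real_trig_potential_def by blast
  have coef_V: "coef V = v" and ev_V: "trig_poly R0 v = ev 0 V"
    unfolding V_def by (rule trig_poly_as_ev[of v R0, OF supp]; assumption)+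
  have V_real: "ev 0 V x \<in> \<real>" for x
    using pot unfolding real_trig_potential_def ev_V by blast
  have norm_V: "norm V \<le> \<epsilon> ^ 9"
    using small(1) \<epsilon> unfolding ev_V star_norm_ev by (simp add: ennreal_less_iff)
  have v0: "v 0 = 0" using supp[of 0] by (auto simp: rvec_simps)
  have v_minus: "v (- q) = cnj (v q)"
    using arg_cong[OF star_eq_self[OF V_real], of "\<lambda>w. coef w (- q)"] by (simp add: coef_star coef_V)
  define \<theta> where "\<theta> = P j t"
  define D where "D m = (norm (rvec m + \<theta>))\<^sup>2" for m
  have D_p: "D m = (p (j + m) t)\<^sup>2" for m
    by (simp add: D_def \<theta>_def p_def P_def rvec_simps add_ac)
  define \<mu> \<mu>' where "\<mu> = model_eigenvalue s v q j t" and "\<mu>' = model_eigenvalue (- s) v q j t"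
  have D0: "D 0 = (p j t)\<^sup>2" and Dq: "D (- q) = (p (j - q) t)\<^sup>2" by (simp_all add: D_p)
  obtain c :: real and d :: complex where unit: "c\<^sup>2 + (cmod d)\<^sup>2 = 1"
    and eig_e: "D 0 * c + v q * d = \<mu> * c" "cnj (v q) * c + D (- q) * d = \<mu> * d"
    and eig_f: "D 0 * (- cnj d) + v q * c = \<mu>' * (- cnj d)" "cnj (v q) * (- cnj d) + D (- q) * c = \<mu>' * c"
    by (rule hermitian_2x2_eigenbasis[OF q(2) s, of "D 0" "D (- q)", unfolded D0 Dq, folded model_eigenvalue_def,
          folded \<mu>_def \<mu>'_def, folded D0 Dq])
  have c2: "c\<^sup>2 \<le> 1" using unit zero_le_power2[of "cmod d"] by linarith
  then have c1: "\<bar>c\<bar> \<le> 1" by (simp add: abs_square_le_1)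
  have unitc: "of_real c * cnj (of_real c) + d * cnj d = 1"
    using arg_cong[OF unit, of complex_of_real]
    by (simp only: of_real_add complex_norm_square of_real_1) (simp add: power2_eq_square)
  define \<tau> where "\<tau> = \<sigma> * (cmod A)\<^sup>2 * c\<^sup>2"
  have tau: "\<bar>\<tau>\<bar> \<le> \<epsilon> ^ 11"
  proof -
    have "\<bar>\<sigma>\<bar> * (cmod A)\<^sup>2 * c\<^sup>2 \<le> \<bar>\<sigma>\<bar> * (cmod A)\<^sup>2 * 1" by (intro mult_left_mono c2) auto
    then show ?thesis using small(3) by (simp add: \<tau>_def abs_mult)
  qed
  have gap: "\<bar>D m - \<mu>\<bar> \<ge> \<epsilon> ^ 6 / 4" if "m \<noteq> 0" "m \<noteq> - q" for m
    unfolding D_p \<mu>_def by (rule resonant_gap[OF sep t s _ _ \<epsilon>]) (use that in \<open>auto simp: eq_neg_iff_add_eq_0 algebra_simps\<close>)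
  \<comment> \<open>The two model eigenvalues differ by the square root in their definition, which
    is at least \<open>2 * cmod (v q)\<close>.\<close>
  have gap2: "\<bar>\<mu> - \<mu>'\<bar> \<ge> 2 * \<epsilon> ^ 10"
  proof -
    let ?h = "sqrt (4 * (cmod (v q))\<^sup>2 + ((p j t)\<^sup>2 - (p (j - q) t)\<^sup>2)\<^sup>2)"
    have "2 * cmod (v q) \<le> ?h" by (rule real_le_rsqrt) (simp add: power_mult_distrib)
    moreover have "\<bar>\<mu> - \<mu>'\<bar> = ?h" using s by (auto simp: \<mu>_def \<mu>'_def model_eigenvalue_def)
    ultimately show ?thesis using small(2) by linarith
  qed
  have V0: "coef V 0 = 0"
    and eig: "D 0 * c + coef V q * d = \<mu> * c" "coef V (- q) * c + D (- q) * d = \<mu> * d"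
      "D 0 * (- cnj d) + coef V q * c = \<mu>' * (- cnj d)" "coef V (- q) * (- cnj d) + D (- q) * c = \<mu>' * c"
    by (simp_all only: coef_V v_minus v0 eig_e eig_f)
  obtain w \<phi> :: "(int ^ 2) ell1" and \<delta> :: complex where w: "w = delta 0 (of_real c) + delta (- q) d + \<phi>" and norm_\<phi>: "norm \<phi> \<le> \<epsilon>"
    and \<delta>: "cmod \<delta> \<le> 17 * \<epsilon> ^ 11"
    and eqn: "\<forall>m. D m * coef w m + coef (conv V w) m + \<tau> * coef (cube w) m = (\<mu> + \<delta>) * coef w m"
    by (rule perturbed_block_solution[OF q(1) \<epsilon> norm_V V0 tau unit eig gap gap2])
  \<comment> \<open>Otherwise \<phi> would cancel the unit vector (c, d), forcing both components
    below \<epsilon>.\<close>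
  have "w \<noteq> 0"
  proof
    assume "w = 0"
    then have "coef w 0 = 0" "coef w (- q) = 0" by (simp_all add: coef_zero)
    then have "of_real c = - coef \<phi> 0" "d = - coef \<phi> (- q)"
      using q(1) by (auto simp: w coef_plus coef_delta eq_neg_iff_add_eq_0)
    then have "\<bar>c\<bar> \<le> \<epsilon>" "cmod d \<le> \<epsilon>"
      using norm_coef_le[of \<phi> 0] norm_coef_le[of \<phi> "- q"] norm_\<phi> by (metis norm_minus_cancel norm_of_real order_trans)+
    then have "\<bar>c\<bar> \<le> 1 / 2" "cmod d \<le> 1 / 2" using \<epsilon> by auto
    then have "c\<^sup>2 \<le> (1 / 2)\<^sup>2" "(cmod d)\<^sup>2 \<le> (1 / 2)\<^sup>2" by (auto simp: abs_le_square_iff[symmetric])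
    then show False using unit by (simp add: power_divide)
  qed
  then have "\<mu> + \<delta> \<in> \<real>" using nonlinear_eigenvalue_real[OF V_real _ eqn[rule_format]] by blast
  then obtain lam :: real where lam: "\<mu> + \<delta> = of_real lam" by (auto elim: Reals_cases)
  define Dw where "Dw = cscale (of_real lam) w - conv V w - cscale (of_real \<tau>) (cube w)"
  have coef_Dw: "coef Dw m = of_real ((norm (rvec m + \<theta>))\<^sup>2) * coef w m" for m
    using eqn[rule_format, of m] unfolding lam D_def by (simp add: Dw_def coef_minus coef_cscale) (simp add: algebra_simps)
  define a where "a = A * of_real c"
  define u where "u = (\<lambda>x. a * ev \<theta> w x)"
  \<comment> \<open>The correction in the final form of \<open>u\<close> gets back the factor
    \<open>c\<close> taken out at the start; \<open>\<bar>c\<bar> \<le> 1\<close> preserves its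
    bound.\<close>
  define g where "g = ev 0 (cscale (of_real c) \<phi>)"
  have pde: "- laplacian u x + trig_poly R0 v x * u x + complex_of_real \<sigma> * complex_of_real ((cmod (u x))\<^sup>2) * u x
      = complex_of_real lam * u x" for x
  proof -
    let ?W = "ev 0 w x" and ?E = "ev \<theta> w x"
    have cmodE: "cmod ?E = cmod ?W" unfolding ev_shift_frequency[of \<theta>] by (simp add: norm_mult)
    have "(cmod (u x))\<^sup>2 = (cmod A)\<^sup>2 * c\<^sup>2 * (cmod ?W)\<^sup>2"
      by (simp add: u_def a_def norm_mult power_mult_distrib cmodE)
    then have cubic: "complex_of_real \<sigma> * complex_of_real ((cmod (u x))\<^sup>2) = \<tau> * complex_of_real ((cmod ?W)\<^sup>2)"
      by (simp add: \<tau>_def)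
    have Dw_x: "ev \<theta> Dw x = lam * ?E - trig_poly R0 v x * ?E - \<tau> * complex_of_real ((cmod ?W)\<^sup>2) * ?E"
      unfolding Dw_def cube_def ev_diff ev_cscale ev_conv ev_star complex_norm_square ev_V by simp
    show ?thesis
      unfolding cubic unfolding u_def smooth_ev(2)[OF coef_Dw] Dw_x by (simp add: algebra_simps)
  qed
  have qp: "quasi_periodic t u"
  proof -
    have cis_eq: "cis (2 * pi * \<theta> $ s) = cis (2 * pi * t $ s)" for s
    proof -
      have "2 * pi * \<theta> $ s = 2 * pi * t $ s + 2 * pi * real_of_int (j $ s)"
        by (simp add: \<theta>_def P_def rvec_simps algebra_simps)
      moreover have "cis (2 * pi * real_of_int (j $ s)) = 1" by (rule cis_multiple_2pi) simp
      ultimately show ?thesis by (simp flip: cis_mult)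
    qed
    show ?thesis
      using smooth_ev(3)[OF coef_Dw, of a] unfolding quasi_periodic_def u_def cis_eq .
  qed
  have form: "u x = A * cis (P j t \<bullet> x) * (psi_lead s v q j t x + g x)" for x
  proof -
    have E: "spectral_proj (model_matrix v q j t) (complex_of_real \<mu>) =
        vector [vector [of_real c * cnj (of_real c), of_real c * cnj d], vector [d * cnj (of_real c), d * cnj d]]"
      by (rule spectral_proj_rank_one[OF _ q(2) unitc, of _ "complex_of_real (D 0)" "complex_of_real (D (- q))"])
         (use eig_e in \<open>simp_all add: model_matrix_def v_minus D0 Dq\<close>)
    \<comment> \<open>\<open>psi_lead\<close> is built from the first column of the projection,
      which is \<open>c\<close> times the eigenvector since \<open>c\<close> is real.\<close>
    have psi: "psi_lead s v q j t x = of_real c * (of_real c + d * cis (- (rvec q \<bullet> x)))"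
      using q(1) by (simp add: psi_lead_def model_proj_def Let_def E[unfolded \<mu>_def] vector_2 algebra_simps)
    have "ev 0 w x = of_real c + d * cis (- (rvec q \<bullet> x)) + ev 0 \<phi> x"
      by (simp add: w ev_add ev_delta rvec_simps)
    then show ?thesis
      unfolding u_def a_def g_def ev_shift_frequency[of \<theta>] psi ev_cscale by (simp add: \<theta>_def algebra_simps)
  qed
  have "lam - \<mu> = Re \<delta>" using arg_cong[OF lam, of Re] by simp
  then have shift: "\<bar>lam - \<mu>\<bar> \<le> 17 * \<epsilon> ^ 11" using abs_Re_le_cmod[of \<delta>] \<delta> by linarith
  have "norm (cscale (of_real c) \<phi>) \<le> \<epsilon>"
    using mult_mono[OF c1 norm_\<phi>] by (simp add: norm_cscale)
  then have "star_norm g \<le> ennreal \<epsilon>" unfolding g_def star_norm_ev by (rule ennreal_leI)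
  moreover have "periodic2 g" unfolding g_def periodic2_def ev_period by simp
  moreover have "continuous_on UNIV g" unfolding g_def by (rule continuous_on_ev)
  moreover have "C2 u" unfolding u_def by (rule smooth_ev(1)[OF coef_Dw])
  ultimately show ?thesis using pde qp form shift unfolding \<mu>_def by blast
qed

theorem theorem39:
  "\<exists>\<epsilon>0>0. \<exists>C::real.
     \<forall>(R0::real) (v :: int ^ 2 \<Rightarrow> complex) (q :: int ^ 2) (c::real).
       real_trig_potential R0 v \<and> q \<noteq> 0 \<and> v q \<noteq> 0 \<longrightarrow>
       (\<exists>k1::real. \<forall>(\<epsilon>::real) (\<sigma>::real) (A::complex) (k::real) (X :: (real ^ 2) set).
          0 < \<epsilon> \<and> \<epsilon> < \<epsilon>0 \<and>
          star_norm (trig_poly R0 v) < ennreal (\<epsilon> ^ 9) \<and>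
          cmod (v q) > \<epsilon> ^ 10 \<and>
          \<bar>\<sigma>\<bar> * (cmod A)\<^sup>2 < \<epsilon> ^ 11 \<and>
          k > k1 \<and>
          resonant_set q c k \<epsilon> X \<and> separated v q k \<epsilon> X \<longrightarrow>
          (\<forall>t\<in>res_nbhd k \<epsilon> X. \<forall>j. near_res_index q k \<epsilon> X t j \<longrightarrow>
             (\<forall>s\<in>{1, -1}. \<exists>(u :: real ^ 2 \<Rightarrow> complex) (lam :: real) (\<phi> :: real ^ 2 \<Rightarrow> complex).
                C2 u \<and>
                (\<forall>x\<in>torus_box.
                   - laplacian u x + trig_poly R0 v x * u x
                     + complex_of_real \<sigma> * complex_of_real ((cmod (u x))\<^sup>2) * u x
                   = complex_of_real lam * u x) \<and>
                quasi_periodic t u \<and>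
                (\<forall>x. u x = A * cis (P j t \<bullet> x) * (psi_lead s v q j t x + \<phi> x)) \<and>
                \<bar>lam - model_eigenvalue s v q j t\<bar> \<le> C * \<epsilon> ^ 11 \<and>
                periodic2 \<phi> \<and> continuous_on UNIV \<phi> \<and> star_norm \<phi> \<le> ennreal \<epsilon>)))"
  \<comment> \<open>17 is the bound on the eigenvalue shift in units of \<epsilon>^11; the same
    instantiated rule supplies both real witnesses, \<open>C\<close> and \<open>k1\<close>.\<close>
  by (rule exI[of _ "1 / 2000"], intro conjI exI[of _ "17 :: real"] allI impI ballI, simp,
      elim conjE, rule nonlinear_resonant_solution) (assumption | linarith)+

end
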